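(* Consider degree $n=4$, the global bilinear in-plane parametrisation, and a mesh satisfying the mesh limitations below (including the Uniform Edge Distribution Condition). Suppose there are no $D$-relevant boundary vertices. Then the $D$-dependency graph is either empty or every connected component of the $D$-dependency graph contains at least one dangling half-edge. Therefore the global classification of $D$- and $T$-type control points exists, and it can be made by successive application of Algorithm A (construction of the $D$-dependency graph), Algorithm B (construction of the $D$-dependency forest) and Algorithm C (classification of $D$- and $T$-type control points based on the forest), all described in the context.
   Context: MESH. A planar simply-connected polygonal domain is subdivided into finitely many strictly convex quadrilaterals (all interior angles less than $\pi$), any two having empty intersection or sharing exactly a common vertex or a common edge. Vertices and edges on the boundary of the domain are called boundary, the others inner; valence = number of incident mesh edges. Mesh limitations: every boundary vertex has valence $2$ (corner vertex) or $3$; every inner edge has at most one boundary vertex; Uniform Edge Distribution Condition: for any vertex of even valence $\ge 6$ having two pairs of collinear edges, the remaining edges do not all belong to the same quadrant formed by the lines containing these collinear edges. An inner vertex of valence $4$ is a regular $4$-vertex if its four edges form two collinear pairs (first with third, second with fourth). CONTROL POINTS ($n=4$). Each element with vertices $A,B,C,D$ is parametrised by $A(1-u)(1-v)+Bu(1-v)+Cuv+D(1-u)v$, and the height $Z$ on it is a tensor-product Bézier polynomial of degree $4$ in $(u,v)$; control points of adjacent elements along a common edge are identified. Let $V$ be a non-corner vertex with edges $e^{(1)},\dots,e^{(N)}$ (vectors directed away from $V$, counter-clockwise; indices mod $N$ if $V$ is inner; if $V$ is boundary, $N=3$ and $e^{(2)}$ is its only inner edge). The $V$-type control point is the one at $V$;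 $E^{(j)}$ ($E$-type) is the first control point after $V$ along $e^{(j)}$; $D^{(j)}$ ($D$-type) is the second one after $V$ along an inner edge $e^{(j)}$ (since $n=4$ it is the middle control point of the edge, common to both ends); $T^{(j)}$ ($T$-type) is the control point with index $(1,1)$ counted from $V$ in the element between $e^{(j)}$ and $e^{(j+1)}$. The same letters denote the corresponding $Z$-values. EQUATIONS. $\langle a,b\rangle=a_Xb_Y-a_Yb_X$. It is assumed that the $V$- and $E$-type control points are already classified (as basic, i.e. independent, or dependent) so that at every non-corner vertex the 3D vectors $\bar\epsilon^{(j)}=(e^{(j)},4(E^{(j)}-V))$ are coplanar (this is the system of "Eq(0)"-type $G^1$-continuity equations). Put $\bar\tau^{(j)}=(t^{(j)},16(V-E^{(j)}+T^{(j)}-E^{(j+1)}))$, where $t^{(j)}$ is the twist vector $A-B+C-D$ of the element between $e^{(j)}$ and $e^{(j+1)}$, with its vertices listed cyclically starting from $A=V$; $tw^{(j)}=\det(\bar\tau^{(j)},\bar\epsilon^{(j)},\bar\epsilon^{(j+1)})/\langle e^{(j)},e^{(j+1)}\rangle^2$; $\delta^{(j)}=12(D^{(j)}-2E^{(j)}+V)$; $\mathrm{coeff}^{(j)}=\langle e^{(j-1)},e^{(j+1)}\rangle/(\langle e^{(j-1)},e^{(j)}\rangle\langle e^{(j)},e^{(j+1)}\rangle)$. The "Eq(1)"-type $G^1$-continuity equation at $V$ for an inner edge $e^{(j)}$ is $tw^{(j)}+tw^{(j-1)}=\mathrm{coeff}^{(j)}\delta^{(j)}$. For an inner vertex of even valence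 the equations at $V$ are solvable for the $tw^{(j)}$ iff the Circular Constraint $\sum_{j=1}^N(-1)^j\mathrm{coeff}^{(j)}\delta^{(j)}=0$ holds. LOCAL TEMPLATES (classification of $D$-, $T$-type points at a single non-corner vertex, so that the Eq(1)-type equations at the vertex hold). Inner vertex of odd valence: all $D$-type points basic, all $T$-type points dependent. Inner vertex of even valence, not a regular $4$-vertex: one $D^{(k)}$ with $\mathrm{coeff}^{(k)}\ne0$ is dependent via the Circular Constraint, the other $D$-type points are basic; one $T$-type point is basic, the others dependent. Regular $4$-vertex: all $D$-type points and one $T$-type point basic, the other $T$-type points dependent. Boundary vertex: either (TB0) $D^{(2)}$ and one of $T^{(1)},T^{(2)}$ basic, the other $T$-type point dependent; or (TB1) $T^{(1)},T^{(2)}$ basic and $D^{(2)}$ dependent. TB1 is used only when the two boundary edges at the vertex are not collinear and a clamped boundary condition (value and normal derivative prescribed) is imposed; otherwise TB0 is used. A vertex is $D$-relevant if its local template contains a dependent $D$-type point: these are the inner vertices of even valence that are not regular $4$-vertices, and the boundary vertices with template TB1. A $D$-relevant vertex uses an adjacent $D^{(j)}$ if $\mathrm{coeff}^{(j)}\neq0$, i.e. if $e^{(j-1)}$ and $e^{(j+1)}$ are not collinear. A $D$-type point is assigned to an adjacent $D$-relevant vertex if it is the dependent $D$-type point in the template of this vertex. The global classification of $D$-, $T$-type control points is said to exist if the local templates of all non-corner vertices can be put together without contradiction, by specifying a traversal order of the vertices and the choice of the dependent $D$-type point (if any) in each template (a contradiction arises when the templates at both ends of an edge make its $D$-type point dependent).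 ALGORITHM A ($D$-dependency graph). (1) Add a secondary vertex in the middle of every mesh edge, splitting it into two half-edges (the mesh vertices are called primary). (2) Delete the half-edge from a primary vertex $V$ to the secondary vertex of an edge if $V$ does not use the $D$-type point of this edge. (3) Delete secondary vertices with no remaining half-edge. (4) Delete primary vertices that are not $D$-relevant. Two primary vertices are connected by a full edge if both half-edges of the mesh edge joining them remain; a half-edge is dangling if its secondary vertex is connected to only one primary vertex. ALGORITHM B ($D$-dependency forest, when every component of the graph has a dangling half-edge). For every connected component: (1) choose a primary vertex $R$ having a dangling half-edge; (2) build a spanning tree of the primary vertices of the component using full edges only; (3) make $R$ its root; (4) direct every mesh edge of the tree from the upper to the lower vertex; (5) direct the mesh edge corresponding to a dangling half-edge at $R$ towards $R$ and include it in the tree of $R$. ALGORITHM C. Step 1: (1) for every $D$-relevant boundary vertex classify the $T$-type points as basic (template TB1); (2) classify as basic the $D$-type points of all mesh edges which remained undirected; (3) for every tree of the forest, assign the $D$-type point of every directed mesh edge to the vertex it points to, traverse the tree from the bottom up, level by level, and at every $D$-relevant vertex $V$ of the level (in any order within the level) take the assigned point $D(V)$ as the dependent $D$-type point of the local template, its dependency on the already classified points being defined by that template (the Circular Constraint if $V$ is inner, the Eq(1)-type equation if $V$ is boundary). Step 2: for every non-corner vertex, excluding $D$-relevant boundary vertices, classify the $T$-type points locally according to the local template. *)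

theory Defs
  imports "HOL-Analysis.Analysis"
begin

section \<open>Quadrilateral meshes\<close>

text \<open>Points and vectors of the plane are complex numbers, X = Re and Y = Im.\<close>

definition cross2 :: "complex \<Rightarrow> complex \<Rightarrow> real" where
  "cross2 a b = Re a * Im b - Im a * Re b"

text \<open>An element is given by its vertices, listed counter-clockwise from an arbitrary one.\<close>

type_synonym quad = "complex \<times> complex \<times> complex \<times> complex"

fun quad_vertices :: "quad \<Rightarrow> complex set" where
  "quad_vertices (A, B, C, D) = {A, B, C, D}"

fun quad_edges :: "quad \<Rightarrow> complex set set" where
  "quad_edges (A, B, C, D) = {{A, B}, {B, C}, {C, D}, {D, A}}"

text \<open>A left turn at each of the four vertices: all interior angles are less than \<open>\<pi>\<close>. (Four
  left turns add up to one full turn, so the closed polygon is also simple.)\<close>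

fun strictly_convex :: "quad \<Rightarrow> bool" where
  "strictly_convex (A, B, C, D) \<longleftrightarrow>
     cross2 (B - A) (C - B) > 0 \<and> cross2 (C - B) (D - C) > 0 \<and>
     cross2 (D - C) (A - D) > 0 \<and> cross2 (A - D) (B - A) > 0"

definition element :: "quad \<Rightarrow> complex set" where
  "element q = convex hull (quad_vertices q)"

definition region :: "quad set \<Rightarrow> complex set" where
  "region M = (\<Union>q\<in>M. element q)"

text \<open>The domain is the interior of the closed region covered by the elements; it is polygonal
  because the region is a finite union of quadrilaterals. The intersection condition also
  prevents an element from occurring in two different cyclic listings.\<close>

definition quad_mesh :: "quad set \<Rightarrow> bool" where
  "quad_mesh M \<longleftrightarrow>
     finite M \<and> M \<noteq> {} \<and> (\<forall>q\<in>M. strictly_convex q) \<and>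
     (\<forall>q\<in>M. \<forall>q'\<in>M. q \<noteq> q' \<longrightarrow>
        element q \<inter> element q' = {} \<or>
        (\<exists>P \<in> quad_vertices q \<inter> quad_vertices q'. element q \<inter> element q' = {P}) \<or>
        (\<exists>e \<in> quad_edges q \<inter> quad_edges q'. element q \<inter> element q' = convex hull e)) \<and>
     simply_connected (interior (region M))"

definition mesh_vertices :: "quad set \<Rightarrow> complex set" where
  "mesh_vertices M = (\<Union>q\<in>M. quad_vertices q)"

definition mesh_edges :: "quad set \<Rightarrow> complex set set" where
  "mesh_edges M = (\<Union>q\<in>M. quad_edges q)"

definition boundary_vertex :: "quad set \<Rightarrow> complex \<Rightarrow> bool" where
  "boundary_vertex M V \<longleftrightarrow> V \<in> mesh_vertices M \<and> V \<in> frontier (region M)"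

definition inner_vertex :: "quad set \<Rightarrow> complex \<Rightarrow> bool" where
  "inner_vertex M V \<longleftrightarrow> V \<in> mesh_vertices M \<and> V \<notin> frontier (region M)"

definition inner_edge :: "quad set \<Rightarrow> complex set \<Rightarrow> bool" where
  "inner_edge M e \<longleftrightarrow> e \<in> mesh_edges M \<and> \<not> convex hull e \<subseteq> frontier (region M)"

definition valence :: "quad set \<Rightarrow> complex \<Rightarrow> nat" where
  "valence M V = card {e \<in> mesh_edges M. V \<in> e}"

definition neighbours :: "quad set \<Rightarrow> complex \<Rightarrow> complex set" where
  "neighbours M V = {W. {V, W} \<in> mesh_edges M}"

definition noncorner_vertices :: "quad set \<Rightarrow> complex set" where
  "noncorner_vertices M =
     {V \<in> mesh_vertices M. \<not> (boundary_vertex M V \<and> valence M V = 2)}"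

definition quadrant :: "complex \<Rightarrow> complex \<Rightarrow> complex set" where
  "quadrant a b = {s *\<^sub>R a + t *\<^sub>R b | s t. s \<ge> 0 \<and> t \<ge> 0}"

text \<open>In a mesh, two different edges at \<open>V\<close> that are collinear point in opposite directions. The
  four quadrants formed by the lines through \<open>a, V, a'\<close> and \<open>b, V, b'\<close> are thus spanned by one
  edge of each pair.\<close>

definition uniform_edge_distribution :: "quad set \<Rightarrow> bool" where
  "uniform_edge_distribution M \<longleftrightarrow>
     (\<forall>V \<in> mesh_vertices M. even (valence M V) \<and> valence M V \<ge> 6 \<longrightarrow>
        (\<forall>a a' b b'. distinct [a, a', b, b'] \<and> {a, a', b, b'} \<subseteq> neighbours M V \<and>
             collinear {V, a, a'} \<and> collinear {V, b, b'} \<longrightarrow>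
           \<not> (\<exists>p \<in> {a, a'}. \<exists>r \<in> {b, b'}. \<forall>w \<in> neighbours M V - {a, a', b, b'}.
                 w - V \<in> quadrant (p - V) (r - V))))"

definition mesh_limitations :: "quad set \<Rightarrow> bool" where
  "mesh_limitations M \<longleftrightarrow>
     (\<forall>V. boundary_vertex M V \<longrightarrow> valence M V \<in> {2, 3}) \<and>
     (\<forall>e. inner_edge M e \<longrightarrow> card {V \<in> e. boundary_vertex M V} \<le> 1) \<and>
     uniform_edge_distribution M"


section \<open>Counter-clockwise numbering of the edges at a vertex\<close>

text \<open>The same element, listed counter-clockwise from \<open>V\<close>; only meaningful if \<open>V\<close> is one of its
  vertices.\<close>

fun quad_from :: "complex \<Rightarrow> quad \<Rightarrow> quad" where
  "quad_from V (A, B, C, D) =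
     (if V = A then (A, B, C, D) else if V = B then (B, C, D, A)
      else if V = C then (C, D, A, B) else (D, A, B, C))"

text \<open>\<open>q\<close> lies between the edges \<open>V W\<close> and \<open>V U\<close>, the latter following the former
  counter-clockwise.\<close>

definition lies_between :: "quad set \<Rightarrow> complex \<Rightarrow> complex \<Rightarrow> complex \<Rightarrow> quad \<Rightarrow> bool" where
  "lies_between M V W U q \<longleftrightarrow> q \<in> M \<and> (\<exists>C. quad_from V q = (V, W, C, U))"

text \<open>The far ends of the edges at \<open>V\<close>, counter-clockwise: as elements are listed
  counter-clockwise, the successor of an edge \<open>V W\<close> is the other edge at \<open>V\<close> of the element whose
  listing from \<open>V\<close> starts with \<open>V, W\<close>. At an inner vertex this is cyclic; at a non-corner boundary
  vertex the second of the three edges is the inner one. Numbering starts from 0.\<close>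

definition ccw_edges :: "quad set \<Rightarrow> complex \<Rightarrow> complex list \<Rightarrow> bool" where
  "ccw_edges M V ws \<longleftrightarrow>
     distinct ws \<and> set ws = neighbours M V \<and>
     (if boundary_vertex M V
      then (\<forall>j. Suc j < length ws \<longrightarrow> (\<exists>q. lies_between M V (ws ! j) (ws ! Suc j) q)) \<and>
           (\<forall>j < length ws. inner_edge M {V, ws ! j} \<longleftrightarrow> j = 1)
      else (\<forall>j < length ws. \<exists>q. lies_between M V (ws ! j) (ws ! (Suc j mod length ws)) q))"

definition ccw_numbering :: "quad set \<Rightarrow> (complex \<Rightarrow> complex list) \<Rightarrow> bool" where
  "ccw_numbering M num \<longleftrightarrow> (\<forall>V \<in> noncorner_vertices M. ccw_edges M V (num V))"

text \<open>Edge indices are taken modulo the number \<open>N\<close> of edges; the index before \<open>j\<close> is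
  \<open>j + N - 1\<close>.\<close>

definition nbr :: "(complex \<Rightarrow> complex list) \<Rightarrow> complex \<Rightarrow> nat \<Rightarrow> complex" where
  "nbr num V j = num V ! (j mod length (num V))"

definition edge_vec :: "(complex \<Rightarrow> complex list) \<Rightarrow> complex \<Rightarrow> nat \<Rightarrow> complex" where
  "edge_vec num V j = nbr num V j - V"

definition pred_idx :: "(complex \<Rightarrow> complex list) \<Rightarrow> complex \<Rightarrow> nat \<Rightarrow> nat" where
  "pred_idx num V j = j + length (num V) - 1"

definition quad_at :: "quad set \<Rightarrow> (complex \<Rightarrow> complex list) \<Rightarrow> complex \<Rightarrow> nat \<Rightarrow> quad" where
  "quad_at M num V j = (THE q. lies_between M V (nbr num V j) (nbr num V (Suc j)) q)"

definition regular_4_vertex :: "quad set \<Rightarrow> (complex \<Rightarrow> complex list) \<Rightarrow> complex \<Rightarrow> bool" where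
  "regular_4_vertex M num V \<longleftrightarrow>
     inner_vertex M V \<and> valence M V = 4 \<and>
     collinear {V, nbr num V 0, nbr num V 2} \<and> collinear {V, nbr num V 1, nbr num V 3}"


section \<open>Control points and continuity equations for degree 4\<close>

text \<open>Each element is parametrised bilinearly, with a bidegree 4 Bezier height function. These are
  its relevant control points, already identified along common edges.
  \<open>EPt V W\<close> and \<open>DPt {V, W}\<close> are the control points with index (1,0) and (2,0) counted from \<open>V\<close>
  along the edge \<open>V W\<close>; the latter is the same point when counted from \<open>W\<close>. \<open>TPt V q\<close> is the
  control point with index (1,1) counted from \<open>V\<close> in the element \<open>q\<close>.\<close>

datatype control_point =
    VPt complex
  | EPt complex complex
  | DPt "complex set"
  | TPt complex quad

type_synonym heights = "control_point \<Rightarrow> real"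

definition D_pt :: "(complex \<Rightarrow> complex list) \<Rightarrow> complex \<Rightarrow> nat \<Rightarrow> control_point" where
  "D_pt num V j = DPt {V, nbr num V j}"

definition T_pt :: "quad set \<Rightarrow> (complex \<Rightarrow> complex list) \<Rightarrow> complex \<Rightarrow> nat \<Rightarrow> control_point" where
  "T_pt M num V j = TPt V (quad_at M num V j)"

definition T_pts :: "quad set \<Rightarrow> complex \<Rightarrow> control_point set" where
  "T_pts M V = {TPt V q | q. q \<in> M \<and> V \<in> quad_vertices q}"

definition eps :: "(complex \<Rightarrow> complex list) \<Rightarrow> heights \<Rightarrow> complex \<Rightarrow> nat \<Rightarrow> real ^ 3" where
  "eps num Z V j =
     vector [Re (edge_vec num V j), Im (edge_vec num V j),
             4 * (Z (EPt V (nbr num V j)) - Z (VPt V))]"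

fun twist :: "quad \<Rightarrow> complex" where
  "twist (A, B, C, D) = A - B + C - D"

definition tau :: "quad set \<Rightarrow> (complex \<Rightarrow> complex list) \<Rightarrow> heights \<Rightarrow> complex \<Rightarrow> nat \<Rightarrow> real ^ 3" where
  "tau M num Z V j =
     (let t = twist (quad_from V (quad_at M num V j)) in
      vector [Re t, Im t,
              16 * (Z (VPt V) - Z (EPt V (nbr num V j)) + Z (T_pt M num V j)
                    - Z (EPt V (nbr num V (Suc j))))])"

definition tw :: "quad set \<Rightarrow> (complex \<Rightarrow> complex list) \<Rightarrow> heights \<Rightarrow> complex \<Rightarrow> nat \<Rightarrow> real" where
  "tw M num Z V j =
     det (vector [tau M num Z V j, eps num Z V j, eps num Z V (Suc j)] :: real ^ 3 ^ 3)
     / (cross2 (edge_vec num V j) (edge_vec num V (Suc j)))\<^sup>2"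

definition delta :: "(complex \<Rightarrow> complex list) \<Rightarrow> heights \<Rightarrow> complex \<Rightarrow> nat \<Rightarrow> real" where
  "delta num Z V j =
     12 * (Z (D_pt num V j) - 2 * Z (EPt V (nbr num V j)) + Z (VPt V))"

definition coeff :: "(complex \<Rightarrow> complex list) \<Rightarrow> complex \<Rightarrow> nat \<Rightarrow> real" where
  "coeff num V j =
     cross2 (edge_vec num V (pred_idx num V j)) (edge_vec num V (Suc j))
     / (cross2 (edge_vec num V (pred_idx num V j)) (edge_vec num V j)
        * cross2 (edge_vec num V j) (edge_vec num V (Suc j)))"

text \<open>Vectors are coplanar if, as points, they lie in a common plane with the origin.\<close>

definition Eq0_at :: "(complex \<Rightarrow> complex list) \<Rightarrow> heights \<Rightarrow> complex \<Rightarrow> bool" where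
  "Eq0_at num Z V \<longleftrightarrow> coplanar (insert 0 {eps num Z V j | j. j < length (num V)})"

definition Eq1 :: "quad set \<Rightarrow> (complex \<Rightarrow> complex list) \<Rightarrow> heights \<Rightarrow> complex \<Rightarrow> nat \<Rightarrow> bool" where
  "Eq1 M num Z V j \<longleftrightarrow>
     tw M num Z V j + tw M num Z V (pred_idx num V j) = coeff num V j * delta num Z V j"

definition Eq1_at :: "quad set \<Rightarrow> (complex \<Rightarrow> complex list) \<Rightarrow> heights \<Rightarrow> complex \<Rightarrow> bool" where
  "Eq1_at M num Z V \<longleftrightarrow>
     (\<forall>j < length (num V). inner_edge M {V, nbr num V j} \<longrightarrow> Eq1 M num Z V j)"

text \<open>Numbering the edges from 0 instead of 1 only changes the sign of the alternating sum.\<close>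

definition circular_constraint :: "(complex \<Rightarrow> complex list) \<Rightarrow> heights \<Rightarrow> complex \<Rightarrow> bool" where
  "circular_constraint num Z V \<longleftrightarrow>
     (\<Sum>j < length (num V). (-1) ^ j * coeff num V j * delta num Z V j) = 0"


section \<open>Local templates\<close>

text \<open>\<open>clamped\<close> is the set of points at which a clamped boundary condition is imposed.\<close>

definition TB1 :: "quad set \<Rightarrow> (complex \<Rightarrow> complex list) \<Rightarrow> complex set \<Rightarrow> complex \<Rightarrow> bool" where
  "TB1 M num clamped V \<longleftrightarrow>
     boundary_vertex M V \<and> V \<in> noncorner_vertices M \<and> V \<in> clamped \<and>
     \<not> collinear {V, nbr num V 0, nbr num V 2}"

definition D_relevant :: "quad set \<Rightarrow> (complex \<Rightarrow> complex list) \<Rightarrow> complex set \<Rightarrow> complex \<Rightarrow> bool" where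
  "D_relevant M num clamped V \<longleftrightarrow>
     inner_vertex M V \<and> even (valence M V) \<and> \<not> regular_4_vertex M num V \<or>
     TB1 M num clamped V"

text \<open>A local template is described by the set of control points which it makes dependent;
  the following two predicates describe its D-type and its T-type part.\<close>

definition D_template ::
  "quad set \<Rightarrow> (complex \<Rightarrow> complex list) \<Rightarrow> complex set \<Rightarrow> complex \<Rightarrow> control_point set \<Rightarrow> bool" where
  "D_template M num clamped V X \<longleftrightarrow>
     (if TB1 M num clamped V then X = {D_pt num V 1}
      else if inner_vertex M V \<and> even (valence M V) \<and> \<not> regular_4_vertex M num V
      then \<exists>k < length (num V). coeff num V k \<noteq> 0 \<and> X = {D_pt num V k}
      else X = {})"

definition T_template ::
  "quad set \<Rightarrow> (complex \<Rightarrow> complex list) \<Rightarrow> complex set \<Rightarrow> complex \<Rightarrow> control_point set \<Rightarrow> bool" where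
  "T_template M num clamped V X \<longleftrightarrow>
     (if TB1 M num clamped V then X = {}
      else if inner_vertex M V \<and> odd (valence M V) then X = T_pts M V
      else \<exists>t \<in> T_pts M V. X = T_pts M V - {t})"

definition local_template ::
  "quad set \<Rightarrow> (complex \<Rightarrow> complex list) \<Rightarrow> complex set \<Rightarrow> complex \<Rightarrow> control_point set \<Rightarrow> bool" where
  "local_template M num clamped V X \<longleftrightarrow>
     (\<exists>X\<^sub>D X\<^sub>T. D_template M num clamped V X\<^sub>D \<and> T_template M num clamped V X\<^sub>T \<and> X = X\<^sub>D \<union> X\<^sub>T)"

text \<open>The equation by which a template defines its dependent D-type point.\<close>

definition D_rule :: "quad set \<Rightarrow> (complex \<Rightarrow> complex list) \<Rightarrow> heights \<Rightarrow> complex \<Rightarrow> bool" where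
  "D_rule M num Z V \<longleftrightarrow>
     (if inner_vertex M V then circular_constraint num Z V else Eq1 M num Z V 1)"


section \<open>Global classification\<close>

definition D_points :: "quad set \<Rightarrow> control_point set" where
  "D_points M = {DPt e | e. inner_edge M e}"

definition T_points :: "quad set \<Rightarrow> control_point set" where
  "T_points M = (\<Union>V \<in> noncorner_vertices M. T_pts M V)"

text \<open>The D- and T-type points that effectively occur in the Eq(1)-type equations at \<open>V\<close>.\<close>

definition occurring :: "quad set \<Rightarrow> (complex \<Rightarrow> complex list) \<Rightarrow> complex \<Rightarrow> control_point set" where
  "occurring M num V =
     {D_pt num V j | j. j < length (num V) \<and> inner_edge M {V, nbr num V j} \<and> coeff num V j \<noteq> 0}
     \<union> T_pts M V"

text \<open>\<open>B\<close> is the set of basic points, \<open>dep V\<close> the set of points dependent in the template of \<open>V\<close>,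
  and \<open>vs\<close> is the traversal order of the vertices. The templates fit together: no point is
  classified twice, and each dependent point depends only on points which are basic or
  dependent at a vertex traversed earlier, its defining equation being solvable for it. The last
  clause expresses the meaning of basic and dependent: whenever the V- and E-type points satisfy
  the Eq(0)-type equations, the basic D- and T-type points can be chosen freely, and the
  Eq(1)-type equations at all vertices then hold for exactly one choice of the dependent ones.\<close>

definition global_classification ::
  "quad set \<Rightarrow> (complex \<Rightarrow> complex list) \<Rightarrow> complex set \<Rightarrow>
   control_point set \<Rightarrow> (complex \<Rightarrow> control_point set) \<Rightarrow> complex list \<Rightarrow> bool" where
  "global_classification M num clamped B dep vs \<longleftrightarrow>
     distinct vs \<and> set vs = noncorner_vertices M \<and>
     (\<forall>V \<in> set vs. local_template M num clamped V (dep V)) \<and>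
     (\<forall>V \<in> set vs. \<forall>W \<in> set vs. V \<noteq> W \<longrightarrow> dep V \<inter> dep W = {}) \<and>
     B \<inter> (\<Union>V \<in> set vs. dep V) = {} \<and>
     B \<union> (\<Union>V \<in> set vs. dep V) = D_points M \<union> T_points M \<and>
     (\<forall>i < length vs. occurring M num (vs ! i) - dep (vs ! i) \<subseteq> B \<union> (\<Union>k < i. dep (vs ! k))) \<and>
     (\<forall>V \<in> set vs. \<forall>p \<in> dep V \<inter> D_points M. \<forall>Z. \<exists>!x. D_rule M num (Z(p := x)) V) \<and>
     (\<forall>Z. (\<forall>V \<in> set vs. Eq0_at num Z V) \<longrightarrow>
        (\<exists>!Z'. (\<forall>p. p \<notin> (\<Union>V \<in> set vs. dep V) \<longrightarrow> Z' p = Z p) \<and>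
               (\<forall>V \<in> set vs. Eq1_at M num Z' V)))"


section \<open>The D-dependency graph\<close>

text \<open>A secondary vertex is represented by its mesh edge, a half-edge by its primary vertex and
  its mesh edge.\<close>

record dep_graph =
  primaries :: "complex set"
  secondaries :: "complex set set"
  half_edges :: "(complex \<times> complex set) set"

definition uses_D ::
  "quad set \<Rightarrow> (complex \<Rightarrow> complex list) \<Rightarrow> complex set \<Rightarrow> complex \<Rightarrow> complex set \<Rightarrow> bool" where
  "uses_D M num clamped V e \<longleftrightarrow>
     D_relevant M num clamped V \<and>
     (\<exists>j < length (num V). e = {V, nbr num V j} \<and> inner_edge M e \<and> coeff num V j \<noteq> 0)"

definition split_edges :: "quad set \<Rightarrow> dep_graph" where
  "split_edges M =
     \<lparr> primaries = mesh_vertices M, secondaries = mesh_edges M,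
       half_edges = {(V, e). e \<in> mesh_edges M \<and> V \<in> e} \<rparr>"

definition delete_unused ::
  "quad set \<Rightarrow> (complex \<Rightarrow> complex list) \<Rightarrow> complex set \<Rightarrow> dep_graph \<Rightarrow> dep_graph" where
  "delete_unused M num clamped G =
     G\<lparr> half_edges := {(V, e) \<in> half_edges G. uses_D M num clamped V e} \<rparr>"

definition delete_secondaries :: "dep_graph \<Rightarrow> dep_graph" where
  "delete_secondaries G =
     G\<lparr> secondaries := {e \<in> secondaries G. \<exists>V. (V, e) \<in> half_edges G} \<rparr>"

text \<open>Only \<open>D\<close>-relevant vertices use D-type points, so the primary vertices deleted here have no
  half-edges left.\<close>

definition delete_primaries ::
  "quad set \<Rightarrow> (complex \<Rightarrow> complex list) \<Rightarrow> complex set \<Rightarrow> dep_graph \<Rightarrow> dep_graph" where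
  "delete_primaries M num clamped G =
     G\<lparr> primaries := {V \<in> primaries G. D_relevant M num clamped V} \<rparr>"

definition algorithm_A ::
  "quad set \<Rightarrow> (complex \<Rightarrow> complex list) \<Rightarrow> complex set \<Rightarrow> dep_graph" where
  "algorithm_A M num clamped =
     delete_primaries M num clamped
       (delete_secondaries (delete_unused M num clamped (split_edges M)))"

datatype node = Primary complex | Secondary "complex set"

definition nodes :: "dep_graph \<Rightarrow> node set" where
  "nodes G = Primary ` primaries G \<union> Secondary ` secondaries G"

definition adjacency :: "dep_graph \<Rightarrow> (node \<times> node) set" where
  "adjacency G =
     {(Primary V, Secondary e) | V e. (V, e) \<in> half_edges G} \<union>
     {(Secondary e, Primary V) | V e. (V, e) \<in> half_edges G}"

definition graph_components :: "dep_graph \<Rightarrow> node set set" where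
  "graph_components G = {(adjacency G)\<^sup>* `` {x} | x. x \<in> nodes G}"

definition component_primaries :: "node set \<Rightarrow> complex set" where
  "component_primaries C = {V. Primary V \<in> C}"

definition dangling :: "dep_graph \<Rightarrow> complex \<Rightarrow> complex set \<Rightarrow> bool" where
  "dangling G V e \<longleftrightarrow> {W. (W, e) \<in> half_edges G} = {V}"

definition full_edge :: "dep_graph \<Rightarrow> complex set \<Rightarrow> bool" where
  "full_edge G e \<longleftrightarrow> e \<in> secondaries G \<and> (\<forall>V \<in> e. (V, e) \<in> half_edges G)"


section \<open>The D-dependency forest\<close>

definition edge_rel :: "complex set set \<Rightarrow> (complex \<times> complex) set" where
  "edge_rel F = {(U, W). {U, W} \<in> F}"

definition is_cycle :: "complex set set \<Rightarrow> complex list \<Rightarrow> bool" where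
  "is_cycle F ps \<longleftrightarrow>
     length ps \<ge> 3 \<and> distinct ps \<and>
     (\<forall>i < length ps. {ps ! i, ps ! (Suc i mod length ps)} \<in> F)"

definition is_tree :: "complex set \<Rightarrow> complex set set \<Rightarrow> bool" where
  "is_tree P F \<longleftrightarrow>
     (\<forall>e \<in> F. e \<subseteq> P) \<and> (\<forall>U \<in> P. \<forall>W \<in> P. (U, W) \<in> (edge_rel F)\<^sup>*) \<and> (\<nexists>ps. is_cycle F ps)"

text \<open>The level of a vertex of a tree is its distance from the root; the root is the upmost
  vertex.\<close>

definition level :: "complex set set \<Rightarrow> complex \<Rightarrow> complex \<Rightarrow> nat" where
  "level F R V = (LEAST n. (R, V) \<in> (edge_rel F) ^^ n)"

text \<open>The choices made by a run, for every component \<open>C\<close>: the root \<open>rt C\<close>, the mesh edge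
  \<open>dang C\<close> of a dangling half-edge at the root, and the spanning tree with edge set \<open>tree C\<close>.\<close>

definition algorithm_B ::
  "dep_graph \<Rightarrow> (node set \<Rightarrow> complex) \<Rightarrow> (node set \<Rightarrow> complex set) \<Rightarrow>
   (node set \<Rightarrow> complex set set) \<Rightarrow> bool" where
  "algorithm_B G rt dang tree \<longleftrightarrow>
     (\<forall>C \<in> graph_components G.
        rt C \<in> component_primaries C \<and> dangling G (rt C) (dang C) \<and>
        is_tree (component_primaries C) (tree C) \<and> (\<forall>e \<in> tree C. full_edge G e))"

text \<open>The directed mesh edges of the resulting forest, each with the vertex it points to.\<close>

definition directed_edges ::
  "dep_graph \<Rightarrow> (node set \<Rightarrow> complex) \<Rightarrow> (node set \<Rightarrow> complex set) \<Rightarrow>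
   (node set \<Rightarrow> complex set set) \<Rightarrow> (complex set \<times> complex) set" where
  "directed_edges G rt dang tree =
     {({U, W}, W) | U W C. C \<in> graph_components G \<and> {U, W} \<in> tree C \<and>
        level (tree C) (rt C) U < level (tree C) (rt C) W} \<union>
     {(dang C, rt C) | C. C \<in> graph_components G}"


section \<open>Classification based on the forest\<close>

text \<open>Bottom-up, level by level traversals of all the trees of the forest, one tree after the
  other.\<close>

definition forest_traversal ::
  "dep_graph \<Rightarrow> (node set \<Rightarrow> complex) \<Rightarrow> (node set \<Rightarrow> complex set set) \<Rightarrow> complex list \<Rightarrow> bool" where
  "forest_traversal G rt tree us \<longleftrightarrow>
     (\<exists>Cs trav. distinct Cs \<and> set Cs = graph_components G \<and> us = concat (map trav Cs) \<and>
        (\<forall>C \<in> set Cs. distinct (trav C) \<and> set (trav C) = component_primaries C \<and>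
           sorted_wrt (\<lambda>V W. level (tree C) (rt C) V \<ge> level (tree C) (rt C) W) (trav C)))"

text \<open>A run yields the basic points \<open>B\<close>, the points \<open>dep V\<close> made dependent at \<open>V\<close>, and the order
  \<open>vs\<close> in which vertices are treated: the vertices of the forest (Step 1), then the others (Step
  2, where the order is irrelevant). The set \<open>T\<^sub>d V\<close> consists of the T-type points which the
  template of \<open>V\<close> makes dependent; it is empty at \<open>D\<close>-relevant boundary vertices.\<close>

definition algorithm_C ::
  "quad set \<Rightarrow> (complex \<Rightarrow> complex list) \<Rightarrow> complex set \<Rightarrow>
   dep_graph \<Rightarrow> (node set \<Rightarrow> complex) \<Rightarrow> (node set \<Rightarrow> complex set) \<Rightarrow>
   (node set \<Rightarrow> complex set set) \<Rightarrow>
   control_point set \<Rightarrow> (complex \<Rightarrow> control_point set) \<Rightarrow> complex list \<Rightarrow> bool" where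
  "algorithm_C M num clamped G rt dang tree B dep vs \<longleftrightarrow>
     (let E = directed_edges G rt dang tree;
          Bd = {V \<in> noncorner_vertices M. boundary_vertex M V \<and> D_relevant M num clamped V}
      in \<exists>T\<^sub>d us ws.
        (\<forall>V \<in> noncorner_vertices M - Bd. T_template M num clamped V (T\<^sub>d V)) \<and>
        (\<forall>V \<in> Bd. T\<^sub>d V = {}) \<and>
        B = (\<Union>V \<in> Bd. T_pts M V)
            \<union> {DPt e | e. inner_edge M e \<and> (\<nexists>V. (e, V) \<in> E)}
            \<union> (\<Union>V \<in> noncorner_vertices M - Bd. T_pts M V - T\<^sub>d V) \<and>
        (\<forall>V \<in> noncorner_vertices M. dep V = {DPt e | e. (e, V) \<in> E} \<union> T\<^sub>d V) \<and>
        forest_traversal G rt tree us \<and>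
        distinct ws \<and> set ws = {V \<in> noncorner_vertices M. \<not> D_relevant M num clamped V} \<and>
        vs = us @ ws)"

end

theory Submission
  imports Defs
begin

text \<open>Call a vector of the plane upward if it is lexicographically positive. Everything rests on one
  local fact about an inner vertex of even valence that is not a regular 4-vertex: it uses the D-type
  point of at least one upward edge. Indeed, going around the vertex, some upward edge
  \<open>e\<^sub>1\<close> follows an edge \<open>e\<^sub>0\<close> that is not upward. If no upward edge were used, \<open>coeff\<close> would vanish
  at \<open>e\<^sub>1\<close>, so \<open>e\<^sub>2\<close> would be opposite to \<open>e\<^sub>0\<close>, hence upward itself, so that \<open>coeff\<close> would vanish
  there too and \<open>e\<^sub>3\<close> would be opposite to \<open>e\<^sub>1\<close>. No edge enters the sectors between these
  four consecutive edges, so all remaining edges lie in the quadrant spanned by \<open>e\<^sub>3\<close> and \<open>e\<^sub>0\<close>. That is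
  excluded by the Uniform Edge Distribution Condition for valence at least 6, and for valence 4 the
  vertex would be regular (\<open>exists_used_edge_upward\<close>).

  Now take the lexicographically largest primary vertex of a component of the \<open>D\<close>-dependency graph.
  The far end of an upward used edge is larger still, so it is outside the component and cannot use
  the same D-type point: the half-edge is dangling (\<open>dangling_exists\<close>).

  Given a run of Algorithm B, every relevant vertex receives exactly one D-type point that it uses
  (the one of the edge from its parent, or the dangling one at the root), and no D-type point is
  received twice: a dangling edge is not a tree edge, and parents in a tree are unique. The other used
  points that are dependent at all belong to children, which a bottom-up traversal treats earlier.
  The system of all Eq(1)-type equations is therefore block triangular (\<open>triangular_solution\<close>), and
  it remains to solve the block of one vertex. A boundary vertex has a single equation. At an inner
  vertex the equations form a cyclic system
  \<open>x\<^sub>j + x\<^sub>j\<^sub>-\<^sub>1 = r\<^sub>j\<close> for the \<open>tw\<close> values, each an affine function of its own T-type point. For odd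
  valence the system is uniquely solvable; for even valence it has a one-parameter family of
  solutions if the alternating sum of the \<open>r\<^sub>j\<close> vanishes, and none otherwise. This alternating sum is
  the Circular Constraint, which determines the dependent D-type point because its \<open>coeff\<close> is nonzero
  (\<open>local_template_solvable\<close>).\<close>

section \<open>The cross product of plane vectors\<close>

lemma cross2_simps:
  "cross2 (a + b) c = cross2 a c + cross2 b c" "cross2 a (b + c) = cross2 a b + cross2 a c"
  "cross2 (a - b) c = cross2 a c - cross2 b c" "cross2 a (b - c) = cross2 a b - cross2 a c"
  "cross2 (- a) c = - cross2 a c" "cross2 a (- c) = - cross2 a c"
  "cross2 (s *\<^sub>R a) c = s * cross2 a c" "cross2 a (s *\<^sub>R c) = s * cross2 a c"
  "cross2 a a = 0" "cross2 0 a = 0" "cross2 a 0 = 0"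
  by (simp_all add: cross2_def algebra_simps)

lemma cross2_swap: "cross2 b a = - cross2 a b"
  by (simp add: cross2_def)

lemma cross2_pos_nz: "cross2 a b > 0 \<Longrightarrow> a \<noteq> 0 \<and> b \<noteq> 0 \<and> a \<noteq> b"
  by (auto simp: cross2_simps)

lemma cross2_expand:
  assumes "cross2 a b \<noteq> 0"
  shows "z = (cross2 z b / cross2 a b) *\<^sub>R a + (cross2 a z / cross2 a b) *\<^sub>R b"
proof -
  have "cross2 a b *\<^sub>R z = cross2 z b *\<^sub>R a + cross2 a z *\<^sub>R b"
    by (simp add: complex_eq_iff cross2_def algebra_simps)
  hence "(1 / cross2 a b) *\<^sub>R (cross2 a b *\<^sub>R z)
      = (1 / cross2 a b) *\<^sub>R (cross2 z b *\<^sub>R a + cross2 a z *\<^sub>R b)" by simp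
  thus ?thesis using assms by (simp add: scaleR_add_right)
qed

lemma cross2_eq_0_scale:
  assumes "cross2 a b = 0" "a \<noteq> 0"
  shows "\<exists>c. b = c *\<^sub>R a"
proof (cases "Re a = 0")
  case True
  with assms have "Im a \<noteq> 0" "Re b = 0" by (auto simp: complex_eq_iff cross2_def)
  thus ?thesis using True by (intro exI[of _ "Im b / Im a"]) (simp add: complex_eq_iff)
next
  case False
  thus ?thesis using assms
    by (intro exI[of _ "Re b / Re a"]) (simp add: complex_eq_iff cross2_def field_simps)
qed

lemma cross2_segment:
  assumes "x \<in> closed_segment P Q" "y \<in> closed_segment P Q" "z \<in> closed_segment P Q"
  shows "cross2 (y - x) (z - x) = 0"
proof -
  obtain a b c where "x = P + a *\<^sub>R (Q - P)" "y = P + b *\<^sub>R (Q - P)" "z = P + c *\<^sub>R (Q - P)"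
    using assms by (auto simp: closed_segment_def scaleR_diff_left scaleR_diff_right)
  hence "y - x = (b - a) *\<^sub>R (Q - P)" "z - x = (c - a) *\<^sub>R (Q - P)"
    by (simp_all add: scaleR_diff_left)
  thus ?thesis by (metis cross2_simps(7,8,9) mult_zero_right)
qed

lemma collinear_iff_cross2: "collinear {V, a, b} \<longleftrightarrow> cross2 (a - V) (b - V) = 0"
proof -
  have "collinear {V, a, b} \<longleftrightarrow> collinear {a, V, b}" by (simp add: insert_commute)
  also have "\<dots> \<longleftrightarrow> a - V = 0 \<or> b - V = 0 \<or> (\<exists>c. b - V = c *\<^sub>R (a - V))"
    by (subst collinear_3) (simp_all only: collinear_lemma NO_MATCH_def simp_thms)
  also have "\<dots> \<longleftrightarrow> cross2 (a - V) (b - V) = 0"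
    using cross2_eq_0_scale[of "a - V" "b - V"] by (metis cross2_simps(8-11) mult_zero_right)
  finally show ?thesis .
qed

section \<open>Elements and edges around a vertex\<close>

lemma quad_fromD:
  assumes "quad_from V q = (V', W, C, U)" "V' = V"
  shows "V \<in> quad_vertices q" "quad_vertices q = {V, W, C, U}"
    "quad_edges q = {{V, W}, {W, C}, {C, U}, {U, V}}"
    "strictly_convex q \<longleftrightarrow> strictly_convex (V, W, C, U)"
  using assms by (cases q; force split: if_splits)+

lemma quad_from_exists:
  assumes "V \<in> quad_vertices q"
  obtains W C U where "quad_from V q = (V, W, C, U)"
proof -
  obtain A B C D where "q = (A, B, C, D)" by (cases q)
  thus ?thesis using assms that by (cases "V = A"; cases "V = B"; cases "V = C"; force)
qed

lemma corner_cross2: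
  assumes "strictly_convex (V, W, C, U)"
  shows "cross2 (W - V) (U - V) > 0"
  using assms by (simp add: cross2_def algebra_simps)

lemma vertex_on_edge_iff:
  assumes "strictly_convex (V, W, C, U)" "e \<in> {{V, W}, {W, C}, {C, U}, {U, V}}"
    "V \<in> convex hull e"
  shows "e = {V, W} \<or> e = {V, U}"
proof (rule ccontr)
  assume "\<not> ?thesis"
  with assms(2) have "e = {W, C} \<or> e = {C, U}" by (auto simp: insert_commute)
  hence "V \<in> closed_segment W C \<or> V \<in> closed_segment C U"
    using assms(3) by (auto simp: segment_convex_hull)
  hence "cross2 (W - V) (C - V) = 0 \<or> cross2 (C - V) (U - V) = 0"
    using cross2_segment[of V W C W C] cross2_segment[of V C U C U] by auto
  thus False using assms(1) by (auto simp: cross2_def algebra_simps)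
qed

lemma corner_triangle_subset_element:
  assumes "quad_from V q = (V, W, C, U)" "a \<ge> 0" "b \<ge> 0" "a + b \<le> 1"
  shows "V + a *\<^sub>R (W - V) + b *\<^sub>R (U - V) \<in> element q"
proof -
  have "V + a *\<^sub>R (W - V) + b *\<^sub>R (U - V) = (1 - a - b) *\<^sub>R V + a *\<^sub>R W + b *\<^sub>R U"
    by (simp add: algebra_simps)
  also have "\<dots> \<in> convex hull {V, W, U}"
    unfolding convex_hull_3 using assms by force
  also have "\<dots> \<subseteq> element q"
    unfolding element_def quad_fromD(2)[OF assms(1) refl] by (rule hull_mono) auto
  finally show ?thesis .
qed

lemma meshD:
  assumes "quad_mesh M"
  shows "finite M" "q \<in> M \<Longrightarrow> strictly_convex q"
    "q \<in> M \<Longrightarrow> q' \<in> M \<Longrightarrow> q \<noteq> q' \<Longrightarrow> x \<in> element q \<inter> element q' \<Longrightarrow> y \<in> element q \<inter> element q' \<Longrightarrow>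
       x \<noteq> y \<Longrightarrow> \<exists>e \<in> quad_edges q \<inter> quad_edges q'. element q \<inter> element q' = convex hull e"
proof -
  show "finite M" "q \<in> M \<Longrightarrow> strictly_convex q" using assms by (auto simp: quad_mesh_def)
  assume *: "q \<in> M" "q' \<in> M" "q \<noteq> q'" and x: "x \<in> element q \<inter> element q'"
    and y: "y \<in> element q \<inter> element q'" "x \<noteq> y"
  have "element q \<inter> element q' = {} \<or>
        (\<exists>P \<in> quad_vertices q \<inter> quad_vertices q'. element q \<inter> element q' = {P}) \<or>
        (\<exists>e \<in> quad_edges q \<inter> quad_edges q'. element q \<inter> element q' = convex hull e)"
    using assms * unfolding quad_mesh_def by blast
  moreover have "element q \<inter> element q' \<noteq> {}" using x by blast
  moreover have "element q \<inter> element q' \<noteq> {P}" for P using x y by (metis singletonD)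
  ultimately show "\<exists>e \<in> quad_edges q \<inter> quad_edges q'. element q \<inter> element q' = convex hull e"
    by blast
qed

lemma quad_edges_doubleton: "e \<in> quad_edges q \<Longrightarrow> \<exists>P Q. e = {P, Q}"
  by (cases q) auto

text \<open>Two different elements to the left of the same oriented edge would both contain, besides the edge,
  a small triangle on its left side; but the intersection of two elements is contained in a line.\<close>

lemma oriented_edge_element_unique:
  assumes mesh: "quad_mesh M" and q: "q \<in> M" "quad_from V q = (V, W, C, U)"
    and q': "q' \<in> M" "quad_from V q' = (V, W, C', U')"
  shows "q = q'"
proof (rule ccontr)
  assume neq: "q \<noteq> q'"
  have c: "cross2 (W - V) (U - V) > 0" "cross2 (W - V) (U' - V) > 0"
    using q q' meshD(2)[OF mesh] quad_fromD(4) by (blast intro: corner_cross2)+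
  obtain s t where st: "U - V = s *\<^sub>R (W - V) + t *\<^sub>R (U' - V)" "t > 0"
    using cross2_expand[of "W - V" "U' - V" "U - V"] c 
    by (metis divide_pos_pos less_irrefl)
  \<comment> \<open>A point slightly to the left of the midpoint of the edge \<open>V W\<close>; the height \<open>b\<close> is so small that
      it belongs to the corner triangles of both elements.\<close>
  define b where "b = 1 / (2 * (1 + \<bar>s\<bar> + t))"
  have b: "b > 0" using st(2) by (simp add: b_def add_nonneg_pos add_pos_nonneg)
  have "b * (1 + \<bar>s\<bar> + t) = 1 / 2" using st(2) by (simp add: b_def add_pos_nonneg)
  hence "b + b * \<bar>s\<bar> + b * t = 1 / 2" by (simp add: distrib_left)
  moreover have "b * t > 0" "b * \<bar>s\<bar> \<ge> 0" "\<bar>b * s\<bar> = b * \<bar>s\<bar>"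
    using b st(2) by (simp_all add: abs_mult)
  ultimately have bs: "b \<le> 1 / 2" "\<bar>b * s\<bar> \<le> 1 / 2" "b * s + b * t \<le> 1 / 2"
    using b by linarith+
  define z where "z = V + (1/2) *\<^sub>R (W - V) + b *\<^sub>R (U - V)"
  have z': "z = V + (1/2 + b * s) *\<^sub>R (W - V) + (b * t) *\<^sub>R (U' - V)"
    unfolding z_def st(1) by (simp add: scaleR_add_right scaleR_add_left)
  have in_both: "x \<in> element q \<inter> element q'" if "x \<in> {V, W, z}" for x
  proof -
    have "z \<in> element q" unfolding z_def
      by (rule corner_triangle_subset_element[OF q(2)]) (use b bs in auto)
    moreover have "z \<in> element q'" unfolding z'
      by (rule corner_triangle_subset_element[OF q'(2)])
        (use b bs st(2) in \<open>simp, simp, linarith\<close>)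
    moreover have "{V, W} \<subseteq> element q \<inter> element q'"
      unfolding element_def quad_fromD(2)[OF q(2) refl] quad_fromD(2)[OF q'(2) refl]
      by (auto intro: hull_inc)
    ultimately show ?thesis using that by blast
  qed
  have "V \<noteq> W" using c by (auto simp: cross2_simps)
  then obtain e where e: "e \<in> quad_edges q" "element q \<inter> element q' = convex hull e"
    using meshD(3)[OF mesh q(1) q'(1) neq, of V W] in_both by blast
  obtain P Q where "e = {P, Q}" using quad_edges_doubleton[OF e(1)] by blast
  hence "{V, W, z} \<subseteq> closed_segment P Q" using in_both e(2) by (auto simp: segment_convex_hull)
  hence "cross2 (W - V) (z - V) = 0" by (intro cross2_segment) auto
  moreover have "cross2 (W - V) (z - V) = b * cross2 (W - V) (U - V)"
    by (simp add: z_def cross2_simps)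
  ultimately show False using b c(1) by simp
qed

lemma edge_at_corner_iff:
  assumes "strictly_convex q" "quad_from V q = (V, W, C, U)"
  shows "{V, X} \<in> quad_edges q \<longleftrightarrow> X = W \<or> X = U"
proof -
  have "V \<noteq> W" "V \<noteq> C" "V \<noteq> U"
    using assms quad_fromD(4)[OF assms(2) refl] by (auto simp: cross2_def algebra_simps)
  thus ?thesis using quad_fromD(3)[OF assms(2) refl] by (auto simp: doubleton_eq_iff)
qed

lemma neighbours_iff:
  assumes "quad_mesh M"
  shows "X \<in> neighbours M V \<longleftrightarrow> (\<exists>q\<in>M. \<exists>W C U. quad_from V q = (V, W, C, U) \<and> (X = W \<or> X = U))"
    (is "?L \<longleftrightarrow> ?R")
proof
  assume ?L
  then obtain q where q: "q \<in> M" "{V, X} \<in> quad_edges q"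
    by (auto simp: neighbours_def mesh_edges_def)
  hence "V \<in> quad_vertices q" by (cases q) auto
  then obtain W C U where "quad_from V q = (V, W, C, U)" using quad_from_exists by metis
  thus ?R using q edge_at_corner_iff[OF meshD(2)[OF assms q(1)], of V W C U X] by auto
next
  assume ?R
  then obtain q W C U where q: "q \<in> M" "quad_from V q = (V, W, C, U)" "X = W \<or> X = U" by blast
  hence "{V, X} \<in> quad_edges q" using edge_at_corner_iff[OF meshD(2)[OF assms q(1)] q(2)] by blast
  thus ?L using q(1) unfolding neighbours_def mesh_edges_def by blast
qed

text \<open>An edge entering the cone of an element \<open>q\<close> at \<open>V\<close> belongs to some element \<open>q'\<close>, and near \<open>V\<close> it
  lies in both \<open>q\<close> and \<open>q'\<close>. If these differ, their intersection is a common edge that passes through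
  \<open>V\<close>, hence ends there, and is parallel to the given one. As \<open>q'\<close> has only one edge at \<open>V\<close> in this
  direction, the given edge is the common one.\<close>

lemma no_edge_in_sector:
  assumes mesh: "quad_mesh M" and q: "q \<in> M" "quad_from V q = (V, W, C, U)"
    and X: "X \<in> neighbours M V" "X - V = s *\<^sub>R (W - V) + t *\<^sub>R (U - V)" "s \<ge> 0" "t \<ge> 0"
  shows "X = W \<or> X = U"
proof -
  obtain q' W' C' U' where q': "q' \<in> M" "quad_from V q' = (V, W', C', U')" "X = W' \<or> X = U'"
    using X(1) unfolding neighbours_iff[OF mesh] by blast
  note conv = meshD(2)[OF mesh q(1)] meshD(2)[OF mesh q'(1)]
  show ?thesis
  proof (cases "q' = q")
    case True
    thus ?thesis using q q' by auto
  next
    case False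
    have c': "cross2 (W' - V) (U' - V) > 0"
      using corner_cross2 conv(2) quad_fromD(4)[OF q'(2) refl] by blast
    define r where "r = 1 / (1 + s + t)"
    have r: "r > 0" using X(3,4) by (simp add: r_def add_pos_nonneg)
    moreover have "r * (1 + s + t) = 1" using X(3,4) by (simp add: r_def add_pos_nonneg)
    moreover have "r * s \<ge> 0" "r * t \<ge> 0" using r X(3,4) by simp_all
    ultimately have r: "r > 0" "r \<le> 1" "r * s + r * t \<le> 1" by (simp_all add: distrib_left)
    define z where "z = V + r *\<^sub>R (X - V)"
    have "z = V + (r * s) *\<^sub>R (W - V) + (r * t) *\<^sub>R (U - V)"
      unfolding z_def X(2) by (simp add: scaleR_add_right)
    hence "z \<in> element q" using corner_triangle_subset_element[OF q(2), of "r * s" "r * t"] r X by simp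
    moreover have "z \<in> element q'"
      using q'(3) corner_triangle_subset_element[OF q'(2), of r 0]
        corner_triangle_subset_element[OF q'(2), of 0 r] r unfolding z_def by auto
    moreover have V: "V \<in> element q \<inter> element q'"
      unfolding element_def quad_fromD(2)[OF q(2) refl] quad_fromD(2)[OF q'(2) refl]
      by (auto intro: hull_inc)
    moreover have "z \<noteq> V" using r q'(3) cross2_pos_nz[OF c'] unfolding z_def by auto
    ultimately obtain e where e: "e \<in> quad_edges q" "e \<in> quad_edges q'"
      "element q \<inter> element q' = convex hull e" "z \<in> convex hull e"
      using meshD(3)[OF mesh q(1) q'(1) False[symmetric], of z V] by blast
    obtain Y where Y: "e = {V, Y}" "Y = W \<or> Y = U"
      using vertex_on_edge_iff[of V W C U e] e V conv(1) quad_fromD(3,4)[OF q(2) refl] by auto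
    have Y': "Y = W' \<or> Y = U'" using e(2) edge_at_corner_iff[OF conv(2) q'(2)] Y by blast
    have "cross2 (Y - V) (z - V) = 0"
      using e(4) unfolding Y(1) segment_convex_hull[symmetric] by (intro cross2_segment) auto
    hence "cross2 (Y - V) (X - V) = 0" using r by (simp add: z_def cross2_simps(8))
    hence "X = Y" using Y' q'(3) c' cross2_swap[of "W' - V" "U' - V"] by auto
    thus ?thesis using Y by simp
  qed
qed

text \<open>The two corner triangles on both sides of the edge together form a neighbourhood of its midpoint.
  At a boundary vertex this prevents the two boundary edges from bounding a common element on the
  outer side, so that there are only two elements.\<close>

lemma shared_edge_not_in_frontier:
  assumes mesh: "quad_mesh M" and q: "q \<in> M" "quad_from V q = (V, W, C, U)"
    and q': "q' \<in> M" "quad_from V q' = (V, W', C', W)"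
  shows "\<not> convex hull {V, W} \<subseteq> frontier (region M)"
proof -
  define e u w where "e = W - V" and "u = U - V" and "w = W' - V"
  have c: "cross2 e u > 0" "cross2 w e > 0"
    using q q' meshD(2)[OF mesh] quad_fromD(4) unfolding e_def u_def w_def
    by (blast intro: corner_cross2)+
  \<comment> \<open>\<open>S\<close> is given by those strict inequalities among the barycentric conditions of the two triangles
      that hold at the midpoint; the remaining condition is the side of the line \<open>V W\<close>.\<close>
  define S where "S = {z. cross2 (z - V) u > 0} \<inter> {z. cross2 (z - V) u + cross2 e (z - V) < cross2 e u}
     \<inter> {z. cross2 w (z - V) > 0} \<inter> {z. cross2 (z - V) e + cross2 w (z - V) < cross2 w e}"
  have "open S" unfolding S_def cross2_def
    by (intro open_Int open_Collect_less continuous_intros)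
  moreover have "S \<subseteq> region M"
  proof
    fix z assume z: "z \<in> S"
    show "z \<in> region M"
    proof (cases "cross2 e (z - V) \<ge> 0")
      case True
      have "z = V + (cross2 (z - V) u / cross2 e u) *\<^sub>R e + (cross2 e (z - V) / cross2 e u) *\<^sub>R u"
        using cross2_expand[of e u "z - V"] c by (simp add: algebra_simps)
      also have "\<dots> \<in> element q" unfolding e_def u_def
        by (rule corner_triangle_subset_element[OF q(2)])
          (use z True c in \<open>simp_all add: S_def flip: e_def u_def add_divide_distrib\<close>)
      finally show ?thesis using q by (auto simp: region_def)
    next
      case False
      have "z = V + (cross2 (z - V) e / cross2 w e) *\<^sub>R w + (cross2 w (z - V) / cross2 w e) *\<^sub>R e"
        using cross2_expand[of w e "z - V"] c by (simp add: algebra_simps)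
      also have "\<dots> \<in> element q'" unfolding e_def w_def
        by (rule corner_triangle_subset_element[OF q'(2)])
          (use z False c cross2_swap[of e "z - V"] in \<open>simp_all add: S_def flip: e_def w_def add_divide_distrib\<close>)
      finally show ?thesis using q' by (auto simp: region_def)
    qed
  qed
  moreover define m where "m = V + (1/2) *\<^sub>R e"
  have "m \<in> S" using c by (simp add: S_def m_def cross2_simps)
  ultimately have "m \<in> interior (region M)" by (meson interiorI)
  moreover have "m \<in> convex hull {V, W}"
    unfolding segment_convex_hull[symmetric] in_segment m_def e_def
    by (intro exI[of _ "1/2"]) (simp add: complex_eq_iff field_simps)
  ultimately show ?thesis by (auto simp: frontier_def)
qed

lemma mesh_edge_at_vertex_iff:
  "e \<in> mesh_edges M \<and> V \<in> e \<longleftrightarrow> (\<exists>W \<in> neighbours M V. e = {V, W})"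
proof
  assume e: "e \<in> mesh_edges M \<and> V \<in> e"
  then obtain P Q where "e = {P, Q}" using quad_edges_doubleton by (metis UN_E mesh_edges_def)
  with e have "e = {V, P} \<or> e = {V, Q}" by auto
  thus "\<exists>W \<in> neighbours M V. e = {V, W}" using e by (auto simp: neighbours_def)
qed (auto simp: neighbours_def)

lemma mesh_edge_distinct:
  assumes "quad_mesh M" "{V, W} \<in> mesh_edges M"
  shows "V \<noteq> W"
proof -
  have "W \<in> neighbours M V" using assms(2) by (simp add: neighbours_def)
  then obtain q W' C U where q: "q \<in> M" "quad_from V q = (V, W', C, U)" "W = W' \<or> W = U"
    unfolding neighbours_iff[OF assms(1)] by blast
  hence "cross2 (W' - V) (U - V) > 0"
    using corner_cross2 meshD(2)[OF assms(1) q(1)] quad_fromD(4)[OF q(2) refl] by blast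
  thus ?thesis using q(3) by (auto simp: cross2_simps)
qed

lemma valence_eq_card_neighbours:
  assumes "quad_mesh M"
  shows "valence M V = card (neighbours M V)"
proof -
  have "{e \<in> mesh_edges M. V \<in> e} = (\<lambda>W. {V, W}) ` neighbours M V"
    using mesh_edge_at_vertex_iff[of _ M V] by blast
  moreover have "inj_on (\<lambda>W. {V, W}) (neighbours M V)" by (auto simp: inj_on_def doubleton_eq_iff)
  ultimately show ?thesis unfolding valence_def by (simp add: card_image)
qed

text \<open>The setting for everything about a single vertex. The index of an edge is an arbitrary
  natural number, read modulo the number of edges.\<close>

locale numbered_mesh =
  fixes M :: "quad set" and num :: "complex \<Rightarrow> complex list"
  assumes mesh: "quad_mesh M"
    and limitations: "mesh_limitations M"
    and numbering: "ccw_numbering M num"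
begin

abbreviation N :: "complex \<Rightarrow> nat" where "N V \<equiv> length (num V)"

abbreviation W :: "complex \<Rightarrow> nat \<Rightarrow> complex" where "W V j \<equiv> nbr num V j"

abbreviation evec :: "complex \<Rightarrow> nat \<Rightarrow> complex" where "evec V j \<equiv> edge_vec num V j"

text \<open>The elements at a non-corner vertex correspond to the indices below this number.\<close>

definition sectors :: "complex \<Rightarrow> nat" where
  "sectors V = (if boundary_vertex M V then 2 else N V)"

lemma inner_iff_not_boundary:
  "V \<in> noncorner_vertices M \<Longrightarrow> inner_vertex M V \<longleftrightarrow> \<not> boundary_vertex M V"
  by (auto simp: inner_vertex_def boundary_vertex_def noncorner_vertices_def)

lemma inner_noncorner: "inner_vertex M V \<Longrightarrow> V \<in> noncorner_vertices M"
  by (auto simp: inner_vertex_def boundary_vertex_def noncorner_vertices_def)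

context
  fixes V :: complex
  assumes V: "V \<in> noncorner_vertices M"
begin

lemma ccw: "ccw_edges M V (num V)"
  using numbering V by (auto simp: ccw_numbering_def)

lemma distinct_num: "distinct (num V)" and set_num: "set (num V) = neighbours M V"
  using ccw by (auto simp: ccw_edges_def)

lemma valence_eq_length: "valence M V = N V"
  using valence_eq_card_neighbours[OF mesh] set_num distinct_card[OF distinct_num] by simp

lemma N_pos: "N V > 0"
proof -
  obtain q where q: "q \<in> M" "V \<in> quad_vertices q"
    using V by (auto simp: noncorner_vertices_def mesh_vertices_def)
  then obtain A B C where "quad_from V q = (V, A, B, C)" using quad_from_exists by metis
  hence "A \<in> neighbours M V" using q neighbours_iff[OF mesh] by blast
  thus ?thesis using set_num by (cases "num V") auto
qed

lemma boundary_length: "boundary_vertex M V \<Longrightarrow> N V = 3"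
  using V limitations valence_eq_length
  by (auto simp: mesh_limitations_def noncorner_vertices_def)

lemma W_neighbour: "W V j \<in> neighbours M V"
  using N_pos set_num by (metis mod_less_divisor nbr_def nth_mem)

lemma neighbour_W:
  assumes "X \<in> neighbours M V"
  obtains j where "j < N V" "X = W V j"
  using assms set_num by (metis in_set_conv_nth mod_less nbr_def)

lemma W_eq_iff: "W V i = W V j \<longleftrightarrow> i mod N V = j mod N V"
  using N_pos distinct_num by (simp add: nbr_def nth_eq_iff_index_eq)

lemma W_Suc_mod: "W V (Suc (j mod N V)) = W V (Suc j)"
  by (simp add: W_eq_iff mod_Suc_eq)

lemma lies_between_unique:
  "lies_between M V A B q \<Longrightarrow> lies_between M V A B' q' \<Longrightarrow> q = q'"
  unfolding lies_between_def using oriented_edge_element_unique[OF mesh] by blast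

lemma lies_between_quad_at:
  assumes "j < sectors V \<or> \<not> boundary_vertex M V"
  shows "lies_between M V (W V j) (W V (Suc j)) (quad_at M num V j)"
proof -
  have "\<exists>q. lies_between M V (W V j) (W V (Suc j)) q"
  proof (cases "boundary_vertex M V")
    case True
    hence "j < 2" "N V = 3" using assms boundary_length by (auto simp: sectors_def)
    thus ?thesis using ccw True by (auto simp: ccw_edges_def nbr_def)
  next
    case False
    have "j mod N V < N V" using N_pos by simp
    hence "\<exists>q. lies_between M V (num V ! (j mod N V)) (num V ! (Suc (j mod N V) mod N V)) q"
      using ccw False unfolding ccw_edges_def by simp
    thus ?thesis by (simp add: nbr_def mod_Suc_eq)
  qed
  then obtain q where q: "lies_between M V (W V j) (W V (Suc j)) q" ..
  hence "quad_at M num V j = q"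
    unfolding quad_at_def by (intro the_equality) (auto intro: lies_between_unique)
  thus ?thesis using q by simp
qed

lemma lies_between_cross2:
  assumes "lies_between M V A B q"
  shows "cross2 (A - V) (B - V) > 0"
proof -
  obtain C where "q \<in> M" "quad_from V q = (V, A, C, B)"
    using assms by (auto simp: lies_between_def)
  thus ?thesis using corner_cross2 meshD(2)[OF mesh] quad_fromD(4)[OF _ refl] by blast
qed

lemma cross2_evec_Suc:
  assumes "j < sectors V \<or> \<not> boundary_vertex M V"
  shows "cross2 (evec V j) (evec V (Suc j)) > 0"
  using lies_between_cross2[OF lies_between_quad_at[OF assms]] by (simp add: edge_vec_def)

lemma evec_not_in_sector:
  assumes "j < sectors V \<or> \<not> boundary_vertex M V"
    and "evec V k = s *\<^sub>R evec V j + t *\<^sub>R evec V (Suc j)" "s \<ge> 0" "t \<ge> 0"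
  shows "k mod N V = j mod N V \<or> k mod N V = Suc j mod N V"
proof -
  obtain q C where "q \<in> M" "quad_from V q = (V, W V j, C, W V (Suc j))"
    using lies_between_quad_at[OF assms(1)] unfolding lies_between_def by blast
  from no_edge_in_sector[OF mesh this W_neighbour, of k s t] assms(2-)
  show ?thesis by (auto simp: edge_vec_def W_eq_iff)
qed

text \<open>An element at \<open>V\<close> is determined by its first edge. This edge cannot be the last of the three edges
  at a boundary vertex: the element would then end at the first one, which would make that an inner
  edge.\<close>

lemma element_at_vertex:
  assumes q: "q \<in> M" "V \<in> quad_vertices q"
  shows "\<exists>j < sectors V. q = quad_at M num V j"
proof -
  obtain A C B where f: "quad_from V q = (V, A, C, B)" using quad_from_exists q(2) by metis
  hence l: "lies_between M V A B q" using q by (auto simp: lies_between_def)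
  have "A \<in> neighbours M V" "B \<in> neighbours M V" using q f neighbours_iff[OF mesh] by blast+
  then obtain i k where ik: "i < N V" "A = W V i" "k < N V" "B = W V k" by (metis neighbour_W)
  have "i < sectors V"
  proof (cases "boundary_vertex M V")
    case True
    note N3 = boundary_length[OF True]
    show ?thesis
    proof (rule ccontr)
      assume "\<not> ?thesis"
      hence i: "i = 2" using ik N3 True by (simp add: sectors_def)
      have l01: "lies_between M V (W V 0) (W V 1) (quad_at M num V 0)"
        and l12: "lies_between M V (W V 1) (W V 2) (quad_at M num V 1)"
        using lies_between_quad_at[of 0] lies_between_quad_at[of 1] True
        by (simp_all add: sectors_def numeral_2_eq_2)
      have "k = 0 \<or> k = 1 \<or> k = 2" using ik N3 by auto
      moreover have "k \<noteq> 2" using cross2_pos_nz[OF lies_between_cross2[OF l]] ik i by auto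
      moreover have "k \<noteq> 1"
        using lies_between_cross2[OF l] lies_between_cross2[OF l12] ik i
          cross2_swap[of "W V 1 - V" "W V 2 - V"] by auto
      moreover have "k \<noteq> 0"
      proof
        assume k: "k = 0"
        obtain C' where "quad_at M num V 0 \<in> M" "quad_from V (quad_at M num V 0) = (V, W V 0, C', W V 1)"
          using l01 unfolding lies_between_def by blast
        from shared_edge_not_in_frontier[OF mesh this q(1), of "W V i" C] f ik k
        have "\<not> convex hull {V, W V 0} \<subseteq> frontier (region M)" by simp
        hence "inner_edge M {V, W V 0}"
          using W_neighbour by (simp add: inner_edge_def neighbours_def)
        thus False using ccw True N3 by (auto simp: ccw_edges_def nbr_def)
      qed
      ultimately show False by blast
    qed
  qed (use ik in \<open>simp add: sectors_def\<close>)
  moreover have "q = quad_at M num V i"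
    using lies_between_unique l lies_between_quad_at calculation ik by blast
  ultimately show ?thesis by blast
qed

lemma T_pts_eq: "T_pts M V = T_pt M num V ` {..<sectors V}"
proof -
  have "quad_at M num V j \<in> M \<and> V \<in> quad_vertices (quad_at M num V j)" if "j < sectors V" for j
    using lies_between_quad_at[of j] that quad_fromD(1) unfolding lies_between_def by blast
  thus ?thesis using element_at_vertex unfolding T_pts_def T_pt_def image_def by fastforce
qed

lemma sectors_le: "sectors V \<le> N V"
  using boundary_length by (auto simp: sectors_def)

lemma sectors_pos: "sectors V > 0"
  using N_pos by (auto simp: sectors_def)

lemma inj_on_T_pt: "inj_on (T_pt M num V) {..<sectors V}"
proof
  fix i j assume ij: "i \<in> {..<sectors V}" "j \<in> {..<sectors V}" "T_pt M num V i = T_pt M num V j"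
  hence "quad_at M num V i = quad_at M num V j" by (simp add: T_pt_def)
  hence "W V i = W V j" using lies_between_quad_at[of i] lies_between_quad_at[of j] ij
    by (auto simp: lies_between_def)
  thus "i = j" using ij sectors_le by (auto simp: W_eq_iff)
qed

end
end

section \<open>Upward edges at a vertex\<close>

text \<open>A linear functional may take its maximum at several vertices and may vanish on edges. The
  lexicographic order avoids this: any two points are comparable, and of two opposite nonzero vectors
  exactly one is positive.\<close>

definition lexpos :: "complex \<Rightarrow> bool" where
  "lexpos z \<longleftrightarrow> Re z > 0 \<or> Re z = 0 \<and> Im z > 0"

lemma lexpos_scaleR: "c > 0 \<Longrightarrow> lexpos (c *\<^sub>R z) \<longleftrightarrow> lexpos z"
  by (auto simp: lexpos_def zero_less_mult_iff)

lemma lexpos_add: "lexpos a \<Longrightarrow> lexpos b \<Longrightarrow> lexpos (a + b)"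
  by (auto simp: lexpos_def)

lemma lexpos_uminus: "z \<noteq> 0 \<Longrightarrow> lexpos (- z) \<longleftrightarrow> \<not> lexpos z"
  by (auto simp: lexpos_def complex_eq_iff)

text \<open>In a half-plane, lying to the left is a linear order of the directions. The identity in the
  proof expresses \<open>b\<close> as a combination of \<open>a\<close> and \<open>c\<close>.\<close>

lemma lexpos_cross2_trans:
  assumes "lexpos a" "lexpos b" "lexpos c" "cross2 a b > 0" "cross2 b c > 0"
  shows "cross2 a c > 0"
proof -
  have "cross2 a c *\<^sub>R b = cross2 b c *\<^sub>R a + cross2 a b *\<^sub>R c"
    by (simp add: complex_eq_iff cross2_def algebra_simps)
  hence l: "lexpos (cross2 a c *\<^sub>R b)" using assms by (simp add: lexpos_add lexpos_scaleR)
  show ?thesis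
  proof (rule ccontr)
    assume "\<not> ?thesis"
    then consider "cross2 a c = 0" | "- cross2 a c > 0" by linarith
    thus False
    proof cases
      case 2
      have "lexpos ((- cross2 a c) *\<^sub>R b)" using lexpos_scaleR[OF 2] assms by simp
      hence "lexpos (cross2 a c *\<^sub>R b + (- cross2 a c) *\<^sub>R b)" using l lexpos_add by blast
      thus False by (simp add: lexpos_def)
    qed (use l in \<open>simp add: lexpos_def\<close>)
  qed
qed

lemma lexpos_turn:
  assumes "\<And>j. lexpos (f j)" "\<And>j. cross2 (f j) (f (Suc j)) > 0"
  shows "cross2 (f 0) (f (Suc n)) > 0"
  by (induction n) (use assms lexpos_cross2_trans in blast)+

text \<open>A closed sequence of left turns cannot stay in a half-plane, since there left turns are
  transitive; this applies to the vectors \<open>f j\<close> and to their negatives.\<close>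

lemma lexpos_periodic_change:
  assumes "\<And>j. cross2 (f j) (f (Suc j)) > 0" "\<And>j. f (j + n) = f j" "n > (0::nat)"
  shows "\<exists>i. \<not> lexpos (f i) \<and> lexpos (f (Suc i))"
proof -
  have f0: "cross2 (f 0) (f n) = 0" using assms(2)[of 0] by (simp add: cross2_simps)
  have nz: "f j \<noteq> 0" for j using cross2_pos_nz assms(1) by blast
  obtain a where a: "\<not> lexpos (f a)"
    using lexpos_turn[of f "n - 1"] assms f0 by (metis Suc_diff_1 less_irrefl)
  obtain b where b: "lexpos (f b)"
    using lexpos_turn[of "\<lambda>j. - f j" "n - 1"] assms f0 lexpos_uminus[OF nz]
    by (auto simp: cross2_simps)
  \<comment> \<open>By periodicity, a positive member occurs after the nonpositive one.\<close>
  have "f (b + k * n) = f b" for k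
    using assms(2)[of "b + _ * n"] by (induction k) (simp_all add: add.assoc[symmetric] add.commute[of n])
  hence b': "lexpos (f (b + Suc a * n))" using b by metis
  have "a \<le> Suc a * n" using assms(3) by (cases n) auto
  hence le: "a \<le> b + Suc a * n" by simp
  show ?thesis
  proof (rule ccontr)
    assume *: "\<not> ?thesis"
    have "\<not> lexpos (f (b + Suc a * n))"
      using le by (induction rule: dec_induct) (use a * in auto)
    thus False using b' by simp
  qed
qed

lemma add_mod_cancel:
  assumes "k < n" "l < n"
  shows "(i + k) mod n = (i + l) mod n \<longleftrightarrow> k = (l::nat)"
proof -
  have "k = l" if "(i + k) mod n = (i + l) mod n" "k \<le> l" "k < n" "l < n" for k l
    using that mod_eq_dvd_iff_nat[of "i + k" "i + l" n] by (auto dest: dvd_imp_le)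
  thus ?thesis using assms by (metis nat_le_linear)
qed

context numbered_mesh
begin

context
  fixes V :: complex
  assumes V: "V \<in> noncorner_vertices M"
begin

lemma evec_mod: "evec V (j mod N V) = evec V j"
  by (simp add: edge_vec_def W_eq_iff[OF V])

lemma evec_add_N: "evec V (j + N V) = evec V j"
  by (simp add: edge_vec_def W_eq_iff[OF V])

lemma coeff_Suc:
  "coeff num V (Suc i) = cross2 (evec V i) (evec V (i + 2))
     / (cross2 (evec V i) (evec V (i + 1)) * cross2 (evec V (i + 1)) (evec V (i + 2)))"
proof -
  have "pred_idx num V (Suc i) = i + N V" using N_pos[OF V] by (simp add: pred_idx_def)
  thus ?thesis by (simp add: coeff_def evec_add_N)
qed

lemma coeff_mod: "coeff num V (j mod N V) = coeff num V j"
proof -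
  have "pred_idx num V (j mod N V) mod N V = pred_idx num V j mod N V"
    using N_pos[OF V] mod_add_left_eq[of j "N V" "N V - 1"]
    by (simp add: pred_idx_def Nat.add_diff_assoc Suc_le_eq)
  hence "evec V (pred_idx num V (j mod N V)) = evec V (pred_idx num V j)" by (metis evec_mod)
  moreover have "evec V (Suc (j mod N V)) = evec V (Suc j)" by (metis mod_Suc_eq evec_mod)
  ultimately show ?thesis by (simp add: coeff_def evec_mod)
qed

end

lemma opposite_if_coeff_0:
  assumes "inner_vertex M V" "coeff num V (Suc i) = 0"
  shows "\<exists>c > 0. evec V (i + 2) = (- c) *\<^sub>R evec V i"
proof -
  have V: "V \<in> noncorner_vertices M" "\<not> boundary_vertex M V"
    using assms inner_noncorner inner_iff_not_boundary by blast+
  have pos: "cross2 (evec V i) (evec V (i + 1)) > 0" "cross2 (evec V (i + 1)) (evec V (i + 2)) > 0"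
    using cross2_evec_Suc[OF V(1), of i] cross2_evec_Suc[OF V(1), of "i + 1"] V by auto
  hence "cross2 (evec V i) (evec V (i + 2)) = 0" using assms(2) coeff_Suc[OF V(1), of i] by auto
  then obtain c where c: "evec V (i + 2) = c *\<^sub>R evec V i"
    using cross2_eq_0_scale cross2_pos_nz[OF pos(1)] by blast
  have "- c * cross2 (evec V i) (evec V (i + 1)) > 0"
    using pos(2) cross2_swap[of "evec V i" "evec V (i + 1)"] unfolding c by (simp add: cross2_simps)
  hence "- c > 0" using pos(1) by (metis zero_less_mult_pos2)
  thus ?thesis using c by (intro exI[of _ "- c"]) simp
qed

text \<open>The local fact behind the theorem. The indices \<open>i, \<dots>, i + 3\<close> are the edges \<open>e\<^sub>0, \<dots>, e\<^sub>3\<close> of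
  the introduction: if the upward edges \<open>i + 1\<close> and \<open>i + 2\<close> are both unused, the four edges form two
  collinear pairs, and the other edges avoid three of the four quadrants.\<close>

lemma exists_used_edge_upward:
  assumes inner: "inner_vertex M V" and ev: "even (valence M V)" and nreg: "\<not> regular_4_vertex M num V"
  shows "\<exists>j < N V. lexpos (evec V j) \<and> coeff num V j \<noteq> 0"
proof (rule ccontr)
  have V: "V \<in> noncorner_vertices M" "\<not> boundary_vertex M V"
    using inner inner_noncorner inner_iff_not_boundary by blast+
  note N = N_pos[OF V(1)]
  have pos: "cross2 (evec V j) (evec V (Suc j)) > 0" for j using cross2_evec_Suc V by blast
  assume "\<not> ?thesis"
  hence unused: "coeff num V j = 0" if "lexpos (evec V j)" for j
    using that coeff_mod[OF V(1), of j] evec_mod[OF V(1), of j] N by (metis mod_less_divisor)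
  obtain i where i: "\<not> lexpos (evec V i)" "lexpos (evec V (Suc i))"
    using lexpos_periodic_change[OF pos evec_add_N[OF V(1)] N] by blast
  obtain a where a: "a > 0" "evec V (i + 2) = (- a) *\<^sub>R evec V i"
    using opposite_if_coeff_0[OF inner unused[OF i(2)]] by blast
  have nz: "evec V i \<noteq> 0" using cross2_pos_nz pos by blast
  have "lexpos (evec V (Suc (i + 1)))"
    using i(1) lexpos_uminus[OF nz] lexpos_scaleR[OF a(1), of "- evec V i"] a(2) by simp
  from opposite_if_coeff_0[OF inner unused[OF this]]
  obtain b where b: "b > 0" "evec V (i + 3) = (- b) *\<^sub>R evec V (i + 1)"
    by (auto simp: numeral_3_eq_3)
  have a2: "evec V (Suc (i + 1)) = (- a) *\<^sub>R evec V i"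
    and b3: "evec V (Suc (i + 2)) = (- b) *\<^sub>R evec V (i + 1)"
    using a(2) b(2) by (simp_all add: numeral_3_eq_3)
  have coll: "collinear {V, W V i, W V (i + 2)}" "collinear {V, W V (i + 1), W V (i + 3)}"
    using a(2) b(2) by (simp_all add: collinear_iff_cross2 cross2_simps flip: edge_vec_def)
  have "N V \<noteq> 2"
  proof
    assume "N V = 2"
    hence "evec V i = (- a) *\<^sub>R evec V i" using a(2) evec_add_N[OF V(1), of i] by metis
    hence "evec V i + a *\<^sub>R evec V i = 0" by (simp add: eq_neg_iff_add_eq_0)
    hence "(1 + a) *\<^sub>R evec V i = 0" by (simp add: scaleR_add_left)
    thus False using nz a(1) by simp
  qed
  moreover have "even (N V)" using ev valence_eq_length[OF V(1)] by simp
  ultimately have N4: "N V \<ge> 4" using N by presburger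
  show False
  proof (cases "N V = 4")
    case True
    \<comment> \<open>Regularity is stated for the edges numbered 0 to 3, which are a cyclic shift of the four edges.\<close>
    have shift: "W V (i + k) = W V l" if "i mod 4 = r" "(r + k) mod 4 = l" for k l r
      using that mod_mod_trivial[of "r + k" 4] mod_add_left_eq[of i 4 k]
      by (simp add: W_eq_iff[OF V(1)] True)
    have coll': "collinear {V, W V (i + 2), W V (i + 0)}" "collinear {V, W V (i + 3), W V (i + 1)}"
      using coll by (simp_all only: insert_commute add_0_right)
    have "i mod 4 = 0 \<or> i mod 4 = 1 \<or> i mod 4 = 2 \<or> i mod 4 = 3" by presburger
    hence "collinear {V, W V 0, W V 2} \<and> collinear {V, W V 1, W V 3}"
    proof (elim disjE)
      assume r: "i mod 4 = 0"
      have "W V (i + 0) = W V 0" "W V (i + 1) = W V 1" "W V (i + 2) = W V 2" "W V (i + 3) = W V 3"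
        by (rule shift[OF r], simp)+
      thus ?thesis using coll coll' by (simp only: add_0_right)
    next
      assume r: "i mod 4 = 1"
      have "W V (i + 0) = W V 1" "W V (i + 1) = W V 2" "W V (i + 2) = W V 3" "W V (i + 3) = W V 0"
        by (rule shift[OF r], simp)+
      thus ?thesis using coll coll' by (simp only: add_0_right)
    next
      assume r: "i mod 4 = 2"
      have "W V (i + 0) = W V 2" "W V (i + 1) = W V 3" "W V (i + 2) = W V 0" "W V (i + 3) = W V 1"
        by (rule shift[OF r], simp)+
      thus ?thesis using coll coll' by (simp only: add_0_right)
    next
      assume r: "i mod 4 = 3"
      have "W V (i + 0) = W V 3" "W V (i + 1) = W V 0" "W V (i + 2) = W V 1" "W V (i + 3) = W V 2"
        by (rule shift[OF r], simp)+
      thus ?thesis using coll coll' by (simp only: add_0_right)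
    qed
    thus False using nreg inner valence_eq_length[OF V(1)] True by (simp add: regular_4_vertex_def)
  next
    case False
    with N4 \<open>even (N V)\<close> have N6: "N V \<ge> 6" by presburger
    let ?S = "{W V i, W V (i + 2), W V (i + 1), W V (i + 3)}"
    have dist: "distinct [W V i, W V (i + 2), W V (i + 1), W V (i + 3)]"
    proof -
      have "W V (i + k) \<noteq> W V (i + l)" if "k < 4" "l < 4" "k \<noteq> l" for k l
        using add_mod_cancel[of k "N V" l i] N4 that by (simp add: W_eq_iff[OF V(1)])
      note this[of 0 1] this[of 0 2] this[of 0 3] this[of 1 2] this[of 1 3] this[of 2 3]
      thus ?thesis by auto
    qed
    have sub: "?S \<subseteq> neighbours M V" using W_neighbour[OF V(1)] by simp
    have quad: "\<forall>w \<in> neighbours M V - ?S. w - V \<in> quadrant (W V i - V) (W V (i + 3) - V)"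
    proof
      fix w assume w: "w \<in> neighbours M V - ?S"
      then obtain k where k: "w = W V k" using neighbour_W[OF V(1)] by (metis DiffD1)
      have k_neq: "k mod N V \<noteq> (i + l) mod N V" if "l < 4" for l
      proof -
        have "l = 0 \<or> l = 1 \<or> l = 2 \<or> l = 3" using that by auto
        thus ?thesis using w k W_eq_iff[OF V(1), of k "i + l"] by auto
      qed
      have out: "\<not> (s \<ge> 0 \<and> t \<ge> 0)"
        if "l < 3" "evec V k = s *\<^sub>R evec V (i + l) + t *\<^sub>R evec V (Suc (i + l))" for s t l
        using evec_not_in_sector[OF V(1) _ that(2)] V(2) k_neq[of l] k_neq[of "Suc l"] that(1) by auto
      obtain s t where st: "evec V k = s *\<^sub>R evec V i + t *\<^sub>R evec V (Suc i)"
        using cross2_expand[of "evec V i" "evec V (Suc i)"] pos[of i] by (metis less_irrefl)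
      have "\<not> (s \<ge> 0 \<and> t \<ge> 0)" using out[of 0 s t] st by simp
      moreover have "\<not> (- s / a \<ge> 0 \<and> t \<ge> 0)"
      proof -
        have "evec V k = t *\<^sub>R evec V (i + 1) + (- s / a) *\<^sub>R evec V (Suc (i + 1))"
          unfolding a2 using a(1) by (simp add: st)
        from out[OF _ this] show ?thesis by auto
      qed
      moreover have "\<not> (- s / a \<ge> 0 \<and> - t / b \<ge> 0)"
      proof -
        have "evec V k = (- s / a) *\<^sub>R evec V (i + 2) + (- t / b) *\<^sub>R evec V (Suc (i + 2))"
          unfolding a(2) b3 using a(1) b(1) by (simp add: st)
        from out[OF _ this] show ?thesis by auto
      qed
      ultimately have "s \<ge> 0" "- t / b \<ge> 0" using a(1) b(1) by (auto simp: field_simps)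
      moreover have "evec V k = s *\<^sub>R evec V i + (- t / b) *\<^sub>R evec V (i + 3)"
        unfolding b(2) using b(1) by (simp add: st)
      ultimately show "w - V \<in> quadrant (W V i - V) (W V (i + 3) - V)"
        unfolding k quadrant_def edge_vec_def by blast
    qed
    have ued: "uniform_edge_distribution M" using limitations by (simp add: mesh_limitations_def)
    have Vm: "V \<in> mesh_vertices M" using inner by (simp add: inner_vertex_def)
    have "even (valence M V) \<and> valence M V \<ge> 6" using N6 ev valence_eq_length[OF V(1)] by simp
    from ued[unfolded uniform_edge_distribution_def, rule_format, OF Vm this conjI[OF dist conjI[OF sub conjI[OF coll]]]]
    show False using quad by blast
  qed
qed

end

section \<open>Spanning trees and levels\<close>

lemma edge_rel_iff: "(U, W) \<in> edge_rel F \<longleftrightarrow> {U, W} \<in> F"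
  by (simp add: edge_rel_def)

lemma sym_edge_rel: "sym (edge_rel F)"
  by (auto simp: sym_def edge_rel_iff insert_commute)

lemma edge_rel_rtrancl_commute: "(U, W) \<in> (edge_rel F)\<^sup>* \<Longrightarrow> (W, U) \<in> (edge_rel F)\<^sup>*"
  using sym_rtrancl[OF sym_edge_rel] by (rule symD)

lemma rtrancl_leaves_set:
  assumes "(x, y) \<in> r\<^sup>*" "x \<in> S" "y \<notin> S"
  shows "\<exists>u w. (u, w) \<in> r \<and> u \<in> S \<and> w \<notin> S"
  using assms by (induction rule: rtrancl_induct) blast+

text \<open>A cycle through the leaf \<open>w\<close> would enter and leave it through the only edge at \<open>w\<close>, visiting \<open>u\<close>
  twice.\<close>

lemma is_cycle_add_leaf:
  assumes F: "\<forall>e\<in>F. e \<subseteq> S" and w: "w \<notin> S" and u: "u \<noteq> w" and cyc: "is_cycle (insert {u, w} F) ps"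
  shows "is_cycle F ps"
proof -
  let ?n = "length ps"
  have n: "?n \<ge> 3" "distinct ps" and
    e: "\<And>i. i < ?n \<Longrightarrow> {ps ! i, ps ! (Suc i mod ?n)} \<in> insert {u, w} F"
    using cyc by (auto simp: is_cycle_def)
  have only_u: "x = u" if "{x, w} \<in> insert {u, w} F" for x
    using that F w by (auto simp: doubleton_eq_iff)
  have "w \<notin> set ps"
  proof
    assume "w \<in> set ps"
    then obtain i where i: "i < ?n" "ps ! i = w" by (auto simp: in_set_conv_nth)
    define h where "h = (if i = 0 then ?n - 1 else i - 1)"
    have h: "h < ?n" "Suc h mod ?n = i" using i n by (auto simp: h_def)
    have "ps ! h = u" using e[OF h(1)] only_u h(2) i(2) by simp
    moreover have "ps ! (Suc i mod ?n) = u" using e[OF i(1)] only_u i(2) by (simp add: insert_commute)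
    moreover have "Suc i mod ?n < ?n" using n(1) by (intro mod_less_divisor) linarith
    ultimately have "h = Suc i mod ?n" using n(2) h(1) by (simp add: nth_eq_iff_index_eq[symmetric])
    thus False using i n by (auto simp: h_def mod_Suc split: if_splits)
  qed
  hence "{ps ! i, ps ! (Suc i mod ?n)} \<in> F" if "i < ?n" for i
  proof -
    have "Suc i mod ?n < ?n" using n(1) by (intro mod_less_divisor) linarith
    hence "ps ! i \<noteq> w" "ps ! (Suc i mod ?n) \<noteq> w" using \<open>w \<notin> set ps\<close> that by (metis nth_mem)+
    thus ?thesis using e[OF that] by (auto simp: doubleton_eq_iff)
  qed
  thus ?thesis using n by (simp add: is_cycle_def)
qed

lemma is_tree_add_leaf:
  assumes T: "is_tree S F" and w: "w \<notin> S" and u: "u \<in> S"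
  shows "is_tree (insert w S) (insert {u, w} F)"
proof -
  let ?r = "edge_rel (insert {u, w} F)"
  have F: "\<forall>e\<in>F. e \<subseteq> S" and conn: "\<And>x y. x \<in> S \<Longrightarrow> y \<in> S \<Longrightarrow> (x, y) \<in> (edge_rel F)\<^sup>*"
    and acyc: "\<nexists>ps. is_cycle F ps"
    using T by (auto simp: is_tree_def)
  have "edge_rel F \<subseteq> ?r" by (auto simp: edge_rel_def)
  hence mono: "(edge_rel F)\<^sup>* \<subseteq> ?r\<^sup>*" by (rule rtrancl_mono)
  have xu: "(x, u) \<in> ?r\<^sup>*" if "x \<in> insert w S" for x
  proof (cases "x = w")
    case True
    hence "(x, u) \<in> ?r" by (simp add: edge_rel_iff insert_commute)
    thus ?thesis by blast
  next
    case False
    thus ?thesis using that conn[OF _ u] mono by blast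
  qed
  have "(x, y) \<in> ?r\<^sup>*" if "x \<in> insert w S" "y \<in> insert w S" for x y
    using xu[OF that(1)] edge_rel_rtrancl_commute[OF xu[OF that(2)]] by (rule rtrancl_trans)
  moreover have "\<nexists>ps. is_cycle (insert {u, w} F) ps"
    using is_cycle_add_leaf[OF F w] acyc u w by metis
  ultimately show ?thesis using F u unfolding is_tree_def by blast
qed

text \<open>A tree that does not yet contain all vertices is extended by an edge leaving it.\<close>

lemma spanning_tree_exists:
  assumes fin: "finite P" and E: "\<forall>e\<in>E. e \<subseteq> P"
    and conn: "\<And>U W. U \<in> P \<Longrightarrow> W \<in> P \<Longrightarrow> (U, W) \<in> (edge_rel E)\<^sup>*"
  shows "\<exists>F \<subseteq> E. is_tree P F"
proof (cases "P = {}")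
  case False
  then obtain R where R: "R \<in> P" by blast
  have "\<exists>S F. S \<subseteq> P \<and> R \<in> S \<and> card S = Suc n \<and> F \<subseteq> E \<and> is_tree S F" if "Suc n \<le> card P" for n
    using that
  proof (induction n)
    case 0
    have "is_tree {R} {}" by (force simp: is_tree_def is_cycle_def)
    thus ?case using R by (intro exI[of _ "{R}"] exI[of _ "{}"]) auto
  next
    case (Suc n)
    then obtain S F where SF: "S \<subseteq> P" "R \<in> S" "card S = Suc n" "F \<subseteq> E" "is_tree S F" by auto
    have "S \<noteq> P" using SF(3) Suc.prems by auto
    then obtain p where p: "p \<in> P" "p \<notin> S" using SF(1) by blast
    obtain u w where uw: "{u, w} \<in> E" "u \<in> S" "w \<notin> S"
      using rtrancl_leaves_set[OF conn[OF R p(1)] SF(2) p(2)] by (auto simp: edge_rel_iff)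
    have "card (insert w S) = Suc (Suc n)"
      using SF(1,3) uw(3) fin by (simp add: finite_subset)
    moreover have "insert w S \<subseteq> P" using SF(1) uw E by blast
    ultimately show ?case using SF uw is_tree_add_leaf[OF SF(5) uw(3,2)]
      by (intro exI[of _ "insert w S"] exI[of _ "insert {u, w} F"]) simp
  qed
  from this[of "card P - 1"] obtain S F where
    SF: "S \<subseteq> P" "card S = card P" "F \<subseteq> E" "is_tree S F"
    using R fin by (metis Suc_diff_1 card_gt_0_iff empty_iff order_refl)
  moreover have "S = P" using SF fin by (simp add: card_subset_eq)
  ultimately show ?thesis by blast
next
  case True
  have "is_tree P {}" unfolding True by (force simp: is_tree_def is_cycle_def)
  thus ?thesis by blast
qed

lemma rtrancl_simple_path:
  assumes "(x, y) \<in> r\<^sup>*"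
  shows "\<exists>ps. distinct (x # ps) \<and> last (x # ps) = y \<and>
    (\<forall>i < length ps. ((x # ps) ! i, (x # ps) ! Suc i) \<in> r)"
  using assms
proof (induction rule: converse_rtrancl_induct)
  case base
  show ?case by (intro exI[of _ "[]"]) simp
next
  case (step x x')
  then obtain ps where ps: "distinct (x' # ps)" "last (x' # ps) = y"
    "\<And>i. i < length ps \<Longrightarrow> ((x' # ps) ! i, (x' # ps) ! Suc i) \<in> r" by blast
  show ?case
  proof (cases "x \<in> set (x' # ps)")
    case True
    then obtain as bs where ab: "x' # ps = as @ x # bs" by (meson split_list)
    have "((x # bs) ! i, (x # bs) ! Suc i) \<in> r" if "i < length bs" for i
    proof -
      have "length (x' # ps) = length as + Suc (length bs)" unfolding ab by simp
      with that have "length as + i < length ps" by simp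
      from ps(3)[OF this] show ?thesis unfolding ab by (simp add: nth_append)
    qed
    moreover have "distinct (x # bs)" using ps(1) unfolding ab by simp
    moreover have "last (x # bs) = y" using ps(2) unfolding ab by simp
    ultimately show ?thesis by blast
  next
    case False
    have "((x # x' # ps) ! i, (x # x' # ps) ! Suc i) \<in> r" if "i < length (x' # ps)" for i
      using that ps(3) step(1) by (cases i) auto
    thus ?thesis using False ps by (intro exI[of _ "x' # ps"]) auto
  qed
qed

text \<open>If two different neighbours of \<open>V\<close> are connected by a path avoiding \<open>V\<close>, a simple such path
  closes up through \<open>V\<close>. It has at least two vertices, so the cycle has at least three.\<close>

lemma two_connections_make_cycle:
  assumes e: "{U1, V} \<in> F" "{U2, V} \<in> F" and ne: "U1 \<noteq> U2" "U1 \<noteq> V"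
    and path: "(U1, U2) \<in> {(x, y) \<in> edge_rel F. y \<noteq> V}\<^sup>*"
  shows "\<exists>ps. is_cycle F ps"
proof -
  obtain ps where ps: "distinct (U1 # ps)" "last (U1 # ps) = U2"
    "\<And>i. i < length ps \<Longrightarrow> {(U1 # ps) ! i, (U1 # ps) ! Suc i} \<in> F \<and> (U1 # ps) ! Suc i \<noteq> V"
    using rtrancl_simple_path[OF path] by (auto simp: edge_rel_iff)
  have "ps \<noteq> []" using ps(2) ne by auto
  moreover have "V \<notin> set ps" using ps(3) by (auto simp: in_set_conv_nth)
  moreover have "{(V # U1 # ps) ! i, (V # U1 # ps) ! (Suc i mod length (V # U1 # ps))} \<in> F"
    if i: "i < length (V # U1 # ps)" for i
  proof (cases "i = length (V # U1 # ps) - 1")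
    case True
    have "(U1 # ps) ! length ps = U2" using ps(2) last_conv_nth[of "U1 # ps"] by simp
    thus ?thesis using True e(2) by simp
  next
    case False
    thus ?thesis using i e(1) ps(3)[of "i - 1"] by (cases i) (auto simp: insert_commute)
  qed
  ultimately have "is_cycle F (V # U1 # ps)"
    using ps(1) ne(2) unfolding is_cycle_def by (cases ps) auto
  thus ?thesis ..
qed

lemma level_path: "(R, V) \<in> (edge_rel F)\<^sup>* \<Longrightarrow> (R, V) \<in> edge_rel F ^^ level F R V"
  unfolding level_def by (rule LeastI_ex) (auto dest: rtrancl_imp_relpow)

lemma level_le: "(R, V) \<in> edge_rel F ^^ n \<Longrightarrow> level F R V \<le> n"
  unfolding level_def by (rule Least_le)

lemma parent_exists:
  assumes reach: "(R, V) \<in> (edge_rel F)\<^sup>*" and V: "V \<noteq> R"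
  shows "\<exists>U. {U, V} \<in> F \<and> (R, U) \<in> (edge_rel F)\<^sup>* \<and> level F R U < level F R V"
proof -
  obtain n where n: "level F R V = Suc n" using level_path[OF reach] V by (cases "level F R V") auto
  then obtain U where "(R, U) \<in> edge_rel F ^^ n" "{U, V} \<in> F"
    using level_path[OF reach] by (auto simp: edge_rel_iff)
  thus ?thesis using n level_le relpow_imp_rtrancl by (metis less_Suc_eq_le)
qed

text \<open>Climbing from parent to parent, the level strictly decreases, so \<open>V\<close> is never met.\<close>

lemma path_to_root_below_level:
  assumes "(R, U) \<in> (edge_rel F)\<^sup>*" "U \<noteq> V" "level F R U \<le> level F R V"
  shows "(U, R) \<in> {(x, y) \<in> edge_rel F. x \<noteq> V \<and> y \<noteq> V}\<^sup>*"
  using assms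
proof (induction "level F R U" arbitrary: U rule: less_induct)
  case less
  show ?case
  proof (cases "U = R")
    case False
    from parent_exists[OF less.prems(1) this] obtain U' where
      U': "{U', U} \<in> F" "(R, U') \<in> (edge_rel F)\<^sup>*" "level F R U' < level F R U" by blast
    hence "U' \<noteq> V" using less.prems by auto
    hence "(U', R) \<in> {(x, y) \<in> edge_rel F. x \<noteq> V \<and> y \<noteq> V}\<^sup>*"
      using less.hyps[OF U'(3,2)] U'(3) less.prems by simp
    moreover have "(U, U') \<in> {(x, y) \<in> edge_rel F. x \<noteq> V \<and> y \<noteq> V}"
      using U'(1) \<open>U' \<noteq> V\<close> less.prems by (simp add: edge_rel_iff insert_commute)
    ultimately show ?thesis by (rule converse_rtrancl_into_rtrancl[rotated])
  qed simp
qed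

text \<open>Two such neighbours are connected through the root without passing \<open>V\<close>.\<close>

lemma parent_unique:
  assumes acyc: "\<nexists>ps. is_cycle F ps"
    and e: "{U1, V} \<in> F" "{U2, V} \<in> F" and ne: "U1 \<noteq> V" "U2 \<noteq> V"
    and reach: "(R, U1) \<in> (edge_rel F)\<^sup>*" "(R, U2) \<in> (edge_rel F)\<^sup>*"
    and lev: "level F R U1 \<le> level F R V" "level F R U2 \<le> level F R V"
  shows "U1 = U2"
proof (rule ccontr)
  assume neq: "U1 \<noteq> U2"
  let ?r = "{(x, y) \<in> edge_rel F. x \<noteq> V \<and> y \<noteq> V}"
  have "sym ?r" using sym_edge_rel[of F] by (auto simp: sym_def)
  hence "(U1, U2) \<in> ?r\<^sup>*"
    using path_to_root_below_level[OF reach(1) ne(1) lev(1)]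
      path_to_root_below_level[OF reach(2) ne(2) lev(2)] by (meson rtrancl_trans sym_rtrancl symD)
  moreover have "?r\<^sup>* \<subseteq> {(x, y) \<in> edge_rel F. y \<noteq> V}\<^sup>*" by (rule rtrancl_mono) auto
  ultimately show False using two_connections_make_cycle[OF e neq ne(1)] acyc by blast
qed

section \<open>Cyclic systems\<close>

text \<open>The Eq(1)-type equations at an inner vertex with \<open>n\<close> edges, in terms of its \<open>tw\<close> values.\<close>

definition cyclic_system :: "nat \<Rightarrow> (nat \<Rightarrow> real) \<Rightarrow> (nat \<Rightarrow> real) \<Rightarrow> bool" where
  "cyclic_system n r x \<longleftrightarrow> (\<forall>j < n. x j + x ((j + n - 1) mod n) = r j)"

text \<open>The index starts at 1: eliminating along the cycle from \<open>x 0\<close> onwards uses the equations 1 to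
  \<open>n - 1\<close>, while equation 0 closes the cycle.\<close>

definition alt_sum :: "(nat \<Rightarrow> real) \<Rightarrow> nat \<Rightarrow> real" where
  "alt_sum r j = (\<Sum>i<j. (-1) ^ Suc i * r (Suc i))"

lemma cyclic_system_iff:
  assumes "n > 0"
  shows "cyclic_system n r x \<longleftrightarrow>
    (\<forall>j < n. x j = (-1) ^ j * (x 0 + alt_sum r j)) \<and> x 0 + x (n - 1) = r 0"
proof -
  have "cyclic_system n r x \<longleftrightarrow> (\<forall>j. Suc j < n \<longrightarrow> x (Suc j) + x j = r (Suc j)) \<and> x 0 + x (n - 1) = r 0"
    (is "_ \<longleftrightarrow> ?S \<and> ?c")
  proof -
    have split: "(\<forall>j < n. P j) \<longleftrightarrow> (\<forall>j. Suc j < n \<longrightarrow> P (Suc j)) \<and> P 0" for P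
      using assms by (auto, rename_tac j, case_tac j) auto
    thus ?thesis unfolding cyclic_system_def using assms by (subst split) simp
  qed
  also have "?S \<longleftrightarrow> (\<forall>j < n. x j = (-1) ^ j * (x 0 + alt_sum r j))"
  proof
    assume s: ?S
    have "x j = (-1) ^ j * (x 0 + alt_sum r j)" if "j < n" for j
      using that
    proof (induction j)
      case (Suc j)
      have "x (Suc j) + x j = r (Suc j)" using s Suc.prems by blast
      hence "x (Suc j) = r (Suc j) - (-1) ^ j * (x 0 + alt_sum r j)" using Suc by simp
      thus ?case by (cases "even j") (simp_all add: alt_sum_def)
    qed (simp add: alt_sum_def)
    thus "\<forall>j < n. x j = (-1) ^ j * (x 0 + alt_sum r j)" by blast
  next
    assume *: "\<forall>j < n. x j = (-1) ^ j * (x 0 + alt_sum r j)"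
    show ?S
    proof (intro allI impI)
      fix j assume j: "Suc j < n"
      have "x (Suc j) = (-1) ^ Suc j * (x 0 + alt_sum r (Suc j))" using * j by blast
      moreover have "x j = (-1) ^ j * (x 0 + alt_sum r j)" using * Suc_lessD[OF j] by blast
      ultimately show "x (Suc j) + x j = r (Suc j)"
        by (cases "even j") (simp_all add: alt_sum_def)
    qed
  qed
  finally show ?thesis .
qed

lemma alternating_sum_eq_alt_sum:
  assumes "n > 0"
  shows "(\<Sum>j<n. (-1) ^ j * r j) = r 0 + alt_sum r (n - 1)"
  using assms sum.lessThan_Suc_shift[of "\<lambda>j. (-1) ^ j * r j" "n - 1"] by (simp add: alt_sum_def)

lemma minus_one_power_pred:
  "n > 0 \<Longrightarrow> (-1 :: real) ^ (n - 1) = (if even n then -1 else 1)"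
  by (cases n) auto

lemma cyclic_system_even_constraint:
  assumes "even n" "cyclic_system n r x"
  shows "(\<Sum>j<n. (-1) ^ j * r j) = 0"
proof (cases "n = 0")
  case False
  hence n: "n - 1 < n" "n > 0" by simp_all
  note X = assms(2)[unfolded cyclic_system_iff[OF n(2)]]
  from X[THEN conjunct1, rule_format, OF n(1)]
  have "x (n - 1) = - (x 0 + alt_sum r (n - 1))"
    unfolding minus_one_power_pred[OF n(2)] using assms(1) by simp
  thus ?thesis using X[THEN conjunct2] False by (simp add: alternating_sum_eq_alt_sum)
qed simp

lemma cyclic_system_even_solvable:
  assumes "even n" "(\<Sum>j<n. (-1) ^ j * r j) = 0" "s < n"
  shows "\<exists>x. cyclic_system n r x \<and> x s = c"
proof -
  \<comment> \<open>The value at 0 is chosen so that the value at \<open>s\<close> becomes \<open>c\<close>.\<close>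
  define x where "x = (\<lambda>j. (-1) ^ j * ((-1) ^ s * c - alt_sum r s + alt_sum r j))"
  have "(-1) ^ s * ((-1) ^ s * c) = c" by (cases "even s") simp_all
  hence "x s = c" by (simp add: x_def)
  moreover have "cyclic_system n r x"
    using assms minus_one_power_pred[of n] alternating_sum_eq_alt_sum[of n r]
    by (subst cyclic_system_iff) (auto simp: x_def alt_sum_def)
  ultimately show ?thesis by blast
qed

lemma cyclic_system_odd_solvable:
  assumes "odd n"
  shows "\<exists>x. cyclic_system n r x"
proof -
  have n: "n > 0" using assms by (cases n) auto
  define x where "x = (\<lambda>j. (-1) ^ j * ((r 0 - alt_sum r (n - 1)) / 2 + alt_sum r j))"
  have "cyclic_system n r x"
    using assms n minus_one_power_pred[of n]
    by (subst cyclic_system_iff) (auto simp: x_def alt_sum_def field_simps)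
  thus ?thesis by blast
qed

lemma cyclic_system_unique:
  assumes x: "cyclic_system n r x" and y: "cyclic_system n r y"
    and s: "odd n \<or> x s = y s \<and> s < n" and j: "j < n"
  shows "x j = y j"
proof -
  have n: "n > 0" "n - 1 < n" using j by simp_all
  note X = x[unfolded cyclic_system_iff[OF n(1)]] and Y = y[unfolded cyclic_system_iff[OF n(1)]]
  note X' = X[THEN conjunct1, rule_format] and Y' = Y[THEN conjunct1, rule_format]
  have "x 0 = y 0"
  proof (cases "odd n")
    case True
    hence "x (n - 1) = x 0 + alt_sum r (n - 1)" "y (n - 1) = y 0 + alt_sum r (n - 1)"
      using X'[OF n(2)] Y'[OF n(2)] unfolding minus_one_power_pred[OF n(1)] by simp_all
    thus ?thesis using X Y by linarith
  next
    case False
    hence "(-1) ^ s * (x 0 + alt_sum r s) = (-1) ^ s * (y 0 + alt_sum r s)"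
      using s X'[of s] Y'[of s] by metis
    thus ?thesis by simp
  qed
  thus ?thesis using X'[OF j] Y'[OF j] by metis
qed

section \<open>The equations at one vertex\<close>

context numbered_mesh
begin

text \<open>V- and E-type points are never dependent, so all heights to be compared agree on them.\<close>

definition same_VE :: "heights \<Rightarrow> heights \<Rightarrow> bool" where
  "same_VE Z Z' \<longleftrightarrow> (\<forall>V. Z (VPt V) = Z' (VPt V)) \<and> (\<forall>V U. Z (EPt V U) = Z' (EPt V U))"

lemma delta_diff:
  "same_VE Z Z' \<Longrightarrow> delta num Z V j - delta num Z' V j = 12 * (Z (D_pt num V j) - Z' (D_pt num V j))"
  by (simp add: delta_def same_VE_def algebra_simps)

text \<open>The determinant defining \<open>tw\<close> is affine in the T-type point, with a coefficient proportional to
  the area spanned by the two edges; hence the \<open>tw\<close> values can replace the T-type points as unknowns.\<close>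

lemma tw_diff:
  assumes "cross2 (evec V j) (evec V (Suc j)) \<noteq> 0" "same_VE Z Z'"
  shows "tw M num Z V j - tw M num Z' V j
    = 16 * (Z (T_pt M num V j) - Z' (T_pt M num V j)) / cross2 (evec V j) (evec V (Suc j))"
proof -
  let ?c = "cross2 (evec V j) (evec V (Suc j))"
  let ?d = "\<lambda>Z. det (vector [tau M num Z V j, eps num Z V j, eps num Z V (Suc j)] :: real ^ 3 ^ 3)"
  have "?d Z - ?d Z' = 16 * (Z (T_pt M num V j) - Z' (T_pt M num V j)) * ?c"
    using assms(2) by (simp add: det_3 tau_def eps_def Let_def same_VE_def cross2_def algebra_simps)
  hence "(?d Z - ?d Z') / ?c\<^sup>2 = 16 * (Z (T_pt M num V j) - Z' (T_pt M num V j)) / ?c"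
    using assms(1) by (simp add: power2_eq_square)
  thus ?thesis by (simp add: tw_def diff_divide_distrib)
qed

context
  fixes V :: complex
  assumes V: "V \<in> noncorner_vertices M"
begin

lemma quad_at_mod: "quad_at M num V (j mod N V) = quad_at M num V j"
proof -
  have "W V (j mod N V) = W V j" by (simp add: W_eq_iff[OF V])
  thus ?thesis by (simp add: quad_at_def W_Suc_mod[OF V])
qed

lemma T_pt_mod: "T_pt M num V (j mod N V) = T_pt M num V j"
  by (simp add: T_pt_def quad_at_mod)

lemma tw_mod: "tw M num Z V (j mod N V) = tw M num Z V j"
proof -
  have "W V (j mod N V) = W V j" by (simp add: W_eq_iff[OF V])
  thus ?thesis
    by (simp add: tw_def tau_def eps_def edge_vec_def W_Suc_mod[OF V] quad_at_mod T_pt_mod)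
qed

lemma D_pt_eq_iff: "D_pt num V j = D_pt num V k \<longleftrightarrow> j mod N V = k mod N V"
proof -
  have "{V, W V j} = {V, W V k} \<longleftrightarrow> W V j = W V k" by (auto simp: doubleton_eq_iff)
  thus ?thesis by (simp add: D_pt_def W_eq_iff[OF V])
qed

lemma Eq1_iff:
  "Eq1 M num Z V j \<longleftrightarrow>
    tw M num Z V j + tw M num Z V ((j + N V - 1) mod N V) = coeff num V j * delta num Z V j"
  by (simp add: Eq1_def tw_mod pred_idx_def)

lemma inner_edge_at_inner_vertex:
  assumes "inner_vertex M V"
  shows "inner_edge M {V, W V j}"
  using assms W_neighbour[OF V, of j]
  by (auto simp: inner_edge_def inner_vertex_def neighbours_def dest!: subsetD[of _ _ V] intro: hull_inc)

lemma Eq1_at_inner_iff: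
  assumes "inner_vertex M V"
  shows "Eq1_at M num Z V \<longleftrightarrow>
    cyclic_system (N V) (\<lambda>j. coeff num V j * delta num Z V j) (tw M num Z V)"
  using inner_edge_at_inner_vertex[OF assms] by (simp add: Eq1_at_def Eq1_iff cyclic_system_def)

lemma Eq1_at_boundary_iff:
  assumes "boundary_vertex M V"
  shows "Eq1_at M num Z V \<longleftrightarrow>
    tw M num Z V 1 + tw M num Z V 0 = coeff num V 1 * delta num Z V 1"
proof -
  note N3 = boundary_length[OF V assms]
  have "inner_edge M {V, W V j} \<longleftrightarrow> j = 1" if "j < N V" for j
    using ccw[OF V] assms that by (simp add: ccw_edges_def nbr_def)
  hence "Eq1_at M num Z V \<longleftrightarrow> Eq1 M num Z V 1" using N3 by (auto simp: Eq1_at_def)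
  thus ?thesis by (simp add: Eq1_iff N3)
qed

text \<open>The equations at \<open>V\<close> ignore D-type points with vanishing \<open>coeff\<close>, so these do not constrain the
  order of elimination.\<close>

lemma Eq1_at_cong:
  assumes "same_VE Z Z'" "\<And>p. p \<in> occurring M num V \<Longrightarrow> Z p = Z' p"
  shows "Eq1_at M num Z V \<longleftrightarrow> Eq1_at M num Z' V"
proof -
  have tw: "tw M num Z V j = tw M num Z' V j" if "j < sectors V" for j
  proof -
    have "T_pt M num V j \<in> occurring M num V"
      using that by (auto simp: occurring_def T_pts_eq[OF V])
    thus ?thesis using tw_diff[of V j Z Z'] cross2_evec_Suc[OF V, of j] assms that by simp
  qed
  have D: "coeff num V j * delta num Z V j = coeff num V j * delta num Z' V j"
    if "j < N V" "inner_edge M {V, W V j}" for j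
  proof (cases "coeff num V j = 0")
    case False
    hence "D_pt num V j \<in> occurring M num V" using that by (auto simp: occurring_def)
    thus ?thesis using delta_diff[OF assms(1), of V j] assms(2) by simp
  qed simp
  have "Eq1 M num Z V j \<longleftrightarrow> Eq1 M num Z' V j" if j: "j < N V" "inner_edge M {V, W V j}" for j
  proof -
    have "j < sectors V \<and> (j + N V - 1) mod N V < sectors V"
    proof (cases "boundary_vertex M V")
      case True
      hence "j = 1" using ccw[OF V] j by (simp add: ccw_edges_def nbr_def)
      thus ?thesis using True boundary_length[OF V True] by (simp add: sectors_def)
    qed (use j N_pos[OF V] in \<open>simp add: sectors_def\<close>)
    thus ?thesis using tw D[OF j] unfolding Eq1_iff by metis
  qed
  thus ?thesis by (auto simp: Eq1_at_def)
qed

lemma heights_with_prescribed_tw: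
  "\<exists>Z'. (\<forall>p. p \<notin> T_pts M V \<longrightarrow> Z' p = Z p) \<and> (\<forall>j < sectors V. tw M num Z' V j = x j)"
proof -
  define h where "h j = Z (T_pt M num V j) + (x j - tw M num Z V j) * cross2 (evec V j) (evec V (Suc j)) / 16" for j
  define Z' where "Z' p = (if p \<in> T_pts M V
    then h (the_inv_into {..<sectors V} (T_pt M num V) p) else Z p)" for p
  have off: "Z' p = Z p" if "p \<notin> T_pts M V" for p using that by (simp add: Z'_def)
  have VE: "same_VE Z' Z" by (auto simp: same_VE_def T_pts_def intro!: off)
  have "tw M num Z' V j = x j" if j: "j < sectors V" for j
  proof -
    have "Z' (T_pt M num V j) = h j"
      using j T_pts_eq[OF V] the_inv_into_f_f[OF inj_on_T_pt[OF V]] by (simp add: Z'_def)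
    thus ?thesis using tw_diff[OF _ VE, of V j] cross2_evec_Suc[OF V, of j] j by (simp add: h_def)
  qed
  thus ?thesis using off by blast
qed

lemma T_pt_eq_if_tw_eq:
  assumes "same_VE Z Z'" "j < sectors V"
  shows "tw M num Z V j = tw M num Z' V j \<longleftrightarrow> Z (T_pt M num V j) = Z' (T_pt M num V j)"
  using tw_diff[OF _ assms(1), of V j] cross2_evec_Suc[OF V, of j] assms(2) by auto

lemma alternating_sum_diff:
  assumes "same_VE Z Z'" "k < N V"
    and off: "\<And>j. j < N V \<Longrightarrow> j \<noteq> k \<Longrightarrow> Z (D_pt num V j) = Z' (D_pt num V j)"
  shows "(\<Sum>j < N V. (-1) ^ j * (coeff num V j * delta num Z V j))
       - (\<Sum>j < N V. (-1) ^ j * (coeff num V j * delta num Z' V j))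
     = (-1) ^ k * coeff num V k * 12 * (Z (D_pt num V k) - Z' (D_pt num V k))"
proof -
  have "(-1) ^ j * (coeff num V j * delta num Z V j) - (-1) ^ j * (coeff num V j * delta num Z' V j)
      = (if j = k then (-1) ^ k * coeff num V k * 12 * (Z (D_pt num V k) - Z' (D_pt num V k)) else 0)"
    if "j < N V" for j
  proof -
    have "(-1) ^ j * (coeff num V j * delta num Z V j) - (-1) ^ j * (coeff num V j * delta num Z' V j)
        = (-1) ^ j * (coeff num V j * (delta num Z V j - delta num Z' V j))" by (simp add: algebra_simps)
    thus ?thesis using off[OF that] by (auto simp: delta_diff[OF assms(1)])
  qed
  thus ?thesis using assms(2) by (simp add: sum.delta flip: sum_subtractf)
qed

lemma circular_constraint_iff:
  "circular_constraint num Z V \<longleftrightarrow> (\<Sum>j < N V. (-1) ^ j * (coeff num V j * delta num Z V j)) = 0"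
  by (simp add: circular_constraint_def mult.assoc)

text \<open>The constraint is affine in the chosen D-type point, with slope \<open>12 coeff\<close> up to sign.\<close>

lemma circular_constraint_unique_D:
  assumes k: "k < N V" "coeff num V k \<noteq> 0"
  shows "\<exists>!d. circular_constraint num (Z(D_pt num V k := d)) V"
proof -
  let ?f = "\<lambda>Z. \<Sum>j < N V. (-1) ^ j * (coeff num V j * delta num Z V j)"
  let ?a = "(-1) ^ k * coeff num V k * 12"
  have f: "?f (Z(D_pt num V k := d)) = ?f Z + ?a * (d - Z (D_pt num V k))" for d
  proof -
    have VE: "same_VE (Z(D_pt num V k := d)) Z" by (simp add: same_VE_def D_pt_def)
    have "(Z(D_pt num V k := d)) (D_pt num V j) = Z (D_pt num V j)" if "j < N V" "j \<noteq> k" for j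
      using that k(1) D_pt_eq_iff[of j k] by simp
    from alternating_sum_diff[OF VE k(1) this] show ?thesis unfolding fun_upd_same by linarith
  qed
  have "circular_constraint num (Z(D_pt num V k := d)) V \<longleftrightarrow> d = Z (D_pt num V k) - ?f Z / ?a" for d
  proof -
    have "c + a * (d - z) = 0 \<longleftrightarrow> d = z - c / a" if "a \<noteq> 0" for a c z :: real
      using that by (auto simp: field_simps)
    moreover have "?a \<noteq> 0" using k(2) by simp
    ultimately show ?thesis unfolding circular_constraint_iff f by blast
  qed
  thus ?thesis by simp
qed

end

lemma regular_4_vertex_coeff:
  assumes "regular_4_vertex M num V" "j < N V"
  shows "coeff num V j = 0"
proof -
  have inner: "inner_vertex M V" using assms by (simp add: regular_4_vertex_def)
  note V = inner_noncorner[OF inner]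
  have N4: "N V = 4" using assms valence_eq_length[OF V] by (simp add: regular_4_vertex_def)
  have c: "cross2 (evec V 0) (evec V 2) = 0" "cross2 (evec V 1) (evec V 3) = 0"
    using assms by (simp_all add: regular_4_vertex_def collinear_iff_cross2 edge_vec_def)
  have "evec V 4 = evec V 0" "evec V 5 = evec V 1" "evec V 6 = evec V 2"
    by (simp_all add: edge_vec_def W_eq_iff[OF V] N4)
  moreover have "j = 0 \<or> j = 1 \<or> j = 2 \<or> j = 3" using assms(2) N4 by auto
  ultimately have "cross2 (evec V (3 + j)) (evec V (Suc j)) = 0"
    using c cross2_swap[of "evec V 1" "evec V 3"] cross2_swap[of "evec V 0" "evec V 2"]
    by (elim disjE) (simp_all add: eval_nat_numeral)
  thus ?thesis by (simp add: coeff_def pred_idx_def N4)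
qed

end

section \<open>Solving the equations of a template\<close>

text \<open>The heights \<open>Z'\<close> solve \<open>Q\<close> and differ from \<open>Z\<close> in the unknowns \<open>X\<close> only.\<close>

definition solves_off :: "(heights \<Rightarrow> bool) \<Rightarrow> control_point set \<Rightarrow> heights \<Rightarrow> heights \<Rightarrow> bool" where
  "solves_off Q X Z Z' \<longleftrightarrow> (\<forall>p. p \<notin> X \<longrightarrow> Z' p = Z p) \<and> Q Z'"

text \<open>Block elimination: each condition can be solved for its own block of unknowns, and no unknown of
  a later block occurs in an earlier condition. For uniqueness, a solution of all conditions is reset
  to \<open>Z\<close> on the last block; the result solves the earlier conditions and is determined by induction.\<close>

lemma triangular_solution:
  fixes dep :: "'v \<Rightarrow> control_point set"
  assumes "\<And>i Z. i < length vs \<Longrightarrow> \<exists>!Z'. solves_off (Q (vs ! i)) (dep (vs ! i)) Z Z'"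
    and "\<And>i k. k < i \<Longrightarrow> i < length vs \<Longrightarrow> dep (vs ! k) \<inter> dep (vs ! i) = {}"
    and "\<And>i k Z Z'. k < i \<Longrightarrow> i < length vs \<Longrightarrow> (\<And>p. p \<notin> dep (vs ! i) \<Longrightarrow> Z p = Z' p) \<Longrightarrow>
      Q (vs ! k) Z = Q (vs ! k) Z'"
  shows "\<exists>!Z'. solves_off (\<lambda>Z'. \<forall>v \<in> set vs. Q v Z') (\<Union>v \<in> set vs. dep v) Z Z'"
  using assms
proof (induction vs rule: rev_induct)
  case Nil
  have "solves_off (\<lambda>Z'. \<forall>v \<in> set []. Q v Z') (\<Union>v \<in> set []. dep v) Z Z' \<longleftrightarrow> Z' = Z" for Z'
    by (auto simp: solves_off_def)
  thus ?case by simp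
next
  case (snoc v vs)
  let ?n = "length vs"
  have pre: "(vs @ [v]) ! k = vs ! k" if "k < ?n" for k using that by (simp add: nth_append)
  have last: "(vs @ [v]) ! ?n = v" by simp
  have "\<exists>!Z'. solves_off (\<lambda>Z'. \<forall>u \<in> set vs. Q u Z') (\<Union>u \<in> set vs. dep u) Z Z'"
  proof (rule snoc.IH)
    show "\<exists>!Z'. solves_off (Q (vs ! i)) (dep (vs ! i)) Z Z'" if "i < ?n" for i Z
      using snoc.prems(1)[of i Z] that pre by simp
    show "dep (vs ! k) \<inter> dep (vs ! i) = {}" if "k < i" "i < ?n" for i k
      using snoc.prems(2)[of k i] that pre by simp
    show "Q (vs ! k) Z = Q (vs ! k) Z'"
      if "k < i" "i < ?n" "\<And>p. p \<notin> dep (vs ! i) \<Longrightarrow> Z p = Z' p" for i k Z Z'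
      using snoc.prems(3)[of k i Z Z'] that pre by simp
  qed
  then obtain Z1 where Z1: "\<And>Z'. solves_off (\<lambda>Z'. \<forall>u \<in> set vs. Q u Z') (\<Union>u \<in> set vs. dep u) Z Z' \<longleftrightarrow> Z' = Z1"
    by (metis (no_types, lifting))
  obtain Z2 where Z2: "\<And>Z'. solves_off (Q v) (dep v) Z1 Z' \<longleftrightarrow> Z' = Z2"
    using snoc.prems(1)[of ?n Z1] unfolding last by (metis length_append_singleton lessI)
  have disj: "dep u \<inter> dep v = {}" if "u \<in> set vs" for u
    using snoc.prems(2)[of _ ?n] that pre unfolding last by (auto simp: in_set_conv_nth)
  have local: "Q u Y = Q u Y'" if "u \<in> set vs" "\<And>p. p \<notin> dep v \<Longrightarrow> Y p = Y' p" for u Y Y'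
    using snoc.prems(3)[of _ ?n Y Y'] that pre unfolding last by (auto simp: in_set_conv_nth)
  have unique: "solves_off (\<lambda>Z'. \<forall>u \<in> set (vs @ [v]). Q u Z') (\<Union>u \<in> set (vs @ [v]). dep u) Z Z'
      \<longleftrightarrow> Z' = Z2" for Z'
  proof
    assume s: "solves_off (\<lambda>Z'. \<forall>u \<in> set (vs @ [v]). Q u Z') (\<Union>u \<in> set (vs @ [v]). dep u) Z Z'"
    define Y where "Y p = (if p \<in> dep v then Z p else Z' p)" for p
    have "\<forall>u \<in> set vs. Q u Y"
      using s local[of _ Y Z'] by (auto simp: solves_off_def Y_def)
    moreover have "Y p = Z p" if "p \<notin> (\<Union>u \<in> set vs. dep u)" for p
      using s that by (auto simp: solves_off_def Y_def)
    ultimately have "Y = Z1" using Z1 unfolding solves_off_def by blast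
    hence "Z' p = Z1 p" if "p \<notin> dep v" for p using that by (metis Y_def)
    moreover have "Q v Z'" using s by (simp add: solves_off_def)
    ultimately have "solves_off (Q v) (dep v) Z1 Z'" unfolding solves_off_def by blast
    thus "Z' = Z2" using Z2 by simp
  next
    assume "Z' = Z2"
    hence s2: "Q v Z'" "\<And>p. p \<notin> dep v \<Longrightarrow> Z' p = Z1 p" using Z2[of Z'] by (auto simp: solves_off_def)
    have s1: "\<forall>u \<in> set vs. Q u Z1" "\<And>p. p \<notin> (\<Union>u \<in> set vs. dep u) \<Longrightarrow> Z1 p = Z p"
      using Z1[of Z1] by (auto simp: solves_off_def)
    have "Q u Z'" if "u \<in> set vs" for u using local[OF that s2(2)] s1(1) that by simp
    thus "solves_off (\<lambda>Z'. \<forall>u \<in> set (vs @ [v]). Q u Z') (\<Union>u \<in> set (vs @ [v]). dep u) Z Z'"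
      using s1 s2 by (auto simp: solves_off_def)
  qed
  show ?case unfolding unique by simp
qed

context numbered_mesh
begin

lemma delta_cong:
  "same_VE Z Z' \<Longrightarrow> Z (D_pt num V j) = Z' (D_pt num V j) \<Longrightarrow> delta num Z V j = delta num Z' V j"
  by (simp add: delta_def same_VE_def)

lemma same_VE_if_equal_off:
  assumes "\<And>p. p \<notin> X \<Longrightarrow> Z p = Z' p" "X \<subseteq> range DPt \<union> T_pts M V"
  shows "same_VE Z Z'"
  using assms by (force simp: same_VE_def T_pts_def)

context
  fixes V :: complex
  assumes V: "V \<in> noncorner_vertices M"
begin

lemma D_pt_notin_T_pts: "D_pt num V j \<notin> T_pts M V"
  by (simp add: D_pt_def T_pts_def)

text \<open>The single equation \<open>tw\<^sub>1 + tw\<^sub>0 = coeff\<^sub>1 \<delta>\<^sub>1\<close> determines one \<open>tw\<close> value from the other.\<close>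

lemma boundary_T_template_solvable:
  assumes bd: "boundary_vertex M V" and t: "t \<in> T_pts M V"
  shows "\<exists>!Z'. solves_off (\<lambda>Z'. Eq1_at M num Z' V) (T_pts M V - {t}) Z Z'"
proof -
  have sec: "sectors V = 2" using bd by (simp add: sectors_def)
  obtain s where s: "s < 2" "t = T_pt M num V s" using t T_pts_eq[OF V] sec by auto
  have dlt: "delta num Z1 V j = delta num Z2 V j" "same_VE Z1 Z2"
    if "\<And>p. p \<notin> T_pts M V \<Longrightarrow> Z1 p = Z2 p" for Z1 Z2 j
  proof -
    show VE: "same_VE Z1 Z2" using same_VE_if_equal_off[of "T_pts M V" Z1 Z2 V] that by blast
    show "delta num Z1 V j = delta num Z2 V j"
      using delta_cong[OF VE that[OF D_pt_notin_T_pts]] .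
  qed
  note eq = Eq1_at_boundary_iff[OF V bd]
  define c where "c = coeff num V 1 * delta num Z V 1"
  obtain Z1 where Z1: "\<And>p. p \<notin> T_pts M V \<Longrightarrow> Z1 p = Z p"
    "\<And>j. j < 2 \<Longrightarrow> tw M num Z1 V j = (if j = s then tw M num Z V s else c - tw M num Z V s)"
    using heights_with_prescribed_tw[OF V, of Z "\<lambda>j. if j = s then tw M num Z V s else c - tw M num Z V s"] sec
    by auto
  have "Z1 t = Z t"
    using T_pt_eq_if_tw_eq[OF V dlt(2)[OF Z1(1)], where j = s] Z1(2)[of s] s sec by simp
  moreover have "delta num Z1 V 1 = delta num Z V 1" by (rule dlt(1)[OF Z1(1)])
  hence "Eq1_at M num Z1 V"
    unfolding eq using Z1(2)[of 0] Z1(2)[of 1] s(1) by (auto simp: c_def)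
  ultimately have ex: "solves_off (\<lambda>Z'. Eq1_at M num Z' V) (T_pts M V - {t}) Z Z1"
    using Z1(1) by (auto simp: solves_off_def)
  have "Z2 = Z1" if "solves_off (\<lambda>Z'. Eq1_at M num Z' V) (T_pts M V - {t}) Z Z2" for Z2
  proof -
    have off: "Z2 p = Z1 p" if "p \<notin> T_pts M V - {t}" for p
      using that ex \<open>solves_off _ _ Z Z2\<close> by (simp add: solves_off_def)
    hence off': "Z2 p = Z1 p" if "p \<notin> T_pts M V" for p using that by blast
    note d = dlt[OF off']
    have "tw M num Z2 V s = tw M num Z1 V s"
      using T_pt_eq_if_tw_eq[OF V d(2)] s sec off by simp
    moreover have "tw M num Z2 V 1 + tw M num Z2 V 0 = tw M num Z1 V 1 + tw M num Z1 V 0"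
      using ex that d(1) by (simp add: solves_off_def eq)
    ultimately have "tw M num Z2 V j = tw M num Z1 V j" if "j < 2" for j
      using that s(1) by (auto simp: less_2_cases_iff)
    hence "Z2 (T_pt M num V j) = Z1 (T_pt M num V j)" if "j < 2" for j
      using T_pt_eq_if_tw_eq[OF V d(2)] sec that by simp
    hence "Z2 p = Z1 p" for p using off' sec T_pts_eq[OF V] by (cases "p \<in> T_pts M V") auto
    thus ?thesis by blast
  qed
  thus ?thesis using ex by blast
qed

text \<open>For even valence, the equations have a solution exactly if the alternating sum of the right-hand
  sides vanishes. This holds identically if all \<open>coeff\<close> vanish; in the template with a dependent \<open>D\<^sub>k\<close> it fixes
  this point. The
  remaining degree of freedom of the cyclic system is the value of the basic T-type point.\<close>

lemma inner_template_solvable: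
  assumes inner: "inner_vertex M V"
    and XT: "if odd (N V) then XT = T_pts M V else \<exists>t \<in> T_pts M V. XT = T_pts M V - {t}"
    and XD: "XD = {} \<and> (odd (N V) \<or> (\<forall>j < N V. coeff num V j = 0)) \<or>
      even (N V) \<and> (\<exists>k < N V. coeff num V k \<noteq> 0 \<and> XD = {D_pt num V k})"
  shows "\<exists>!Z'. solves_off (\<lambda>Z'. Eq1_at M num Z' V) (XD \<union> XT) Z Z'"
proof -
  let ?X = "XD \<union> XT"
  let ?r = "\<lambda>Z j. coeff num V j * delta num Z V j"
  have sec: "sectors V = N V" using inner inner_iff_not_boundary[OF V] by (simp add: sectors_def)
  have sub: "XD \<subseteq> range DPt" "XT \<subseteq> T_pts M V" using XD XT by (auto simp: D_pt_def split: if_splits)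
  obtain s where s: "s < N V" "even (N V) \<Longrightarrow> XT = T_pts M V - {T_pt M num V s}"
  proof (cases "odd (N V)")
    case True
    thus ?thesis using that N_pos[OF V] by blast
  next
    case False
    thus ?thesis using that XT T_pts_eq[OF V] sec by auto
  qed
  have XT': "XT = (if odd (N V) then T_pts M V else T_pts M V - {T_pt M num V s})" using s XT by auto
  note eq = Eq1_at_inner_iff[OF V inner]
  \<comment> \<open>The D-type point comes first, since the cyclic system for the T-type points is solvable only
      once the Circular Constraint holds.\<close>
  obtain Z1 where Z1: "\<And>p. p \<notin> XD \<Longrightarrow> Z1 p = Z p"
    "even (N V) \<Longrightarrow> (\<Sum>j<N V. (-1) ^ j * ?r Z1 j) = 0"
  proof (cases "XD = {}")
    case True
    hence "even (N V) \<Longrightarrow> (\<Sum>j<N V. (-1) ^ j * ?r Z j) = 0" using XD by auto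
    thus ?thesis using that by blast
  next
    case False
    then obtain k where k: "k < N V" "coeff num V k \<noteq> 0" "XD = {D_pt num V k}" using XD by blast
    then obtain d where "circular_constraint num (Z(D_pt num V k := d)) V"
      using circular_constraint_unique_D[OF V k(1,2)] by blast
    thus ?thesis using that[of "Z(D_pt num V k := d)"] k(3)
      unfolding circular_constraint_iff[OF V] by (metis fun_upd_other singletonI)
  qed
  obtain x where x: "cyclic_system (N V) (?r Z1) x" "even (N V) \<Longrightarrow> x s = tw M num Z1 V s"
    using cyclic_system_even_solvable[of "N V" "?r Z1" s] cyclic_system_odd_solvable[of "N V" "?r Z1"]
      Z1(2) s(1) by metis
  obtain Z2 where Z2: "\<And>p. p \<notin> T_pts M V \<Longrightarrow> Z2 p = Z1 p" "\<And>j. j < N V \<Longrightarrow> tw M num Z2 V j = x j"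
    using heights_with_prescribed_tw[OF V, of Z1 x] sec by auto
  have VE: "same_VE Z2 Z1" using same_VE_if_equal_off[of "T_pts M V" Z2 Z1 V] Z2(1) by blast
  have "?r Z2 = ?r Z1" using delta_cong[OF VE Z2(1)[OF D_pt_notin_T_pts]] by simp
  hence "Eq1_at M num Z2 V" unfolding eq using x(1) Z2(2) N_pos[OF V] by (simp add: cyclic_system_def)
  moreover have "Z2 (T_pt M num V s) = Z1 (T_pt M num V s)" if "even (N V)"
    using T_pt_eq_if_tw_eq[OF V VE, of s] Z2(2) x(2) that s(1) sec by simp
  ultimately have ex: "solves_off (\<lambda>Z'. Eq1_at M num Z' V) ?X Z Z2"
    using Z1(1) Z2(1) XT' by (auto simp: solves_off_def split: if_splits)
  have "Z3 = Z2" if Z3: "solves_off (\<lambda>Z'. Eq1_at M num Z' V) ?X Z Z3" for Z3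
  proof -
    have off: "Z3 p = Z2 p" if "p \<notin> ?X" for p using that ex Z3 by (simp add: solves_off_def)
    have VE: "same_VE Z3 Z2" using same_VE_if_equal_off[of ?X Z3 Z2 V] off sub by blast
    have cyc: "cyclic_system (N V) (?r Z3) (tw M num Z3 V)" "cyclic_system (N V) (?r Z2) (tw M num Z2 V)"
      using ex Z3 by (simp_all add: solves_off_def eq)
    have D: "Z3 p = Z2 p" if p: "p \<in> XD" for p
    proof -
      obtain k where k: "even (N V)" "k < N V" "coeff num V k \<noteq> 0" "XD = {D_pt num V k}"
        using XD p by blast
      have "Z3 (D_pt num V j) = Z2 (D_pt num V j)" if "j < N V" "j \<noteq> k" for j
        using that k off[of "D_pt num V j"] D_pt_eq_iff[OF V, of j k] D_pt_notin_T_pts sub(2) by auto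
      from alternating_sum_diff[OF V VE k(2) this]
      have "(-1) ^ k * coeff num V k * 12 * (Z3 (D_pt num V k) - Z2 (D_pt num V k)) = 0"
        using cyclic_system_even_constraint[OF k(1) cyc(1)] cyclic_system_even_constraint[OF k(1) cyc(2)]
        by linarith
      thus ?thesis using k p by simp
    qed
    hence off': "Z3 p = Z2 p" if "p \<notin> XT" for p using that off by blast
    have "Z3 (D_pt num V j) = Z2 (D_pt num V j)" for j using off' D_pt_notin_T_pts sub(2) by blast
    hence "?r Z3 = ?r Z2" using delta_cong[OF VE] by simp
    moreover have "odd (N V) \<or> tw M num Z3 V s = tw M num Z2 V s \<and> s < N V"
      using T_pt_eq_if_tw_eq[OF V VE, of s] s off' sec XT' by auto
    ultimately have "tw M num Z3 V j = tw M num Z2 V j" if "j < N V" for j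
      using cyclic_system_unique[OF cyc(1) _ _ that] cyc(2) by metis
    hence "Z3 (T_pt M num V j) = Z2 (T_pt M num V j)" if "j < N V" for j
      using T_pt_eq_if_tw_eq[OF V VE, of j] that sec by simp
    hence "Z3 p = Z2 p" for p using off' sub(2) sec T_pts_eq[OF V] by (cases "p \<in> T_pts M V") auto
    thus ?thesis by blast
  qed
  thus ?thesis using ex by blast
qed

lemma local_template_solvable:
  assumes tb: "\<not> TB1 M num clamped V" and X: "local_template M num clamped V X"
  shows "\<exists>!Z'. solves_off (\<lambda>Z'. Eq1_at M num Z' V) X Z Z'"
proof -
  obtain XD XT where XX: "D_template M num clamped V XD" "T_template M num clamped V XT" "X = XD \<union> XT"
    using X by (auto simp: local_template_def)
  show ?thesis
  proof (cases "boundary_vertex M V")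
    case True
    hence "\<not> inner_vertex M V" using inner_iff_not_boundary[OF V] by simp
    hence "XD = {}" and "\<exists>t \<in> T_pts M V. XT = T_pts M V - {t}"
      using XX tb by (auto simp: D_template_def T_template_def)
    then obtain t where "t \<in> T_pts M V" "X = T_pts M V - {t}" using XX(3) by auto
    thus ?thesis using boundary_T_template_solvable[OF True] by simp
  next
    case False
    hence inner: "inner_vertex M V" using inner_iff_not_boundary[OF V] by simp
    have "if odd (N V) then XT = T_pts M V else \<exists>t \<in> T_pts M V. XT = T_pts M V - {t}"
      using XX(2) tb inner valence_eq_length[OF V] by (simp add: T_template_def)
    moreover have "XD = {} \<and> (odd (N V) \<or> (\<forall>j < N V. coeff num V j = 0)) \<or>
      even (N V) \<and> (\<exists>k < N V. coeff num V k \<noteq> 0 \<and> XD = {D_pt num V k})"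
      using XX(1) tb inner valence_eq_length[OF V] regular_4_vertex_coeff
      by (auto simp: D_template_def split: if_splits)
    ultimately show ?thesis using inner_template_solvable[OF inner] XX(3) by blast
  qed
qed

end
end

section \<open>Dangling half-edges of the \<open>D\<close>-dependency graph\<close>

lemma lexpos_maximum_exists:
  assumes "finite A" "A \<noteq> {}"
  shows "\<exists>V \<in> A. \<forall>U \<in> A. \<not> lexpos (U - V)"
proof -
  define A' where "A' = {z \<in> A. Re z = Max (Re ` A)}"
  have "Max (Re ` A) \<in> Re ` A" using assms by (intro Max_in) auto
  then obtain z where "z \<in> A" "Re z = Max (Re ` A)" by auto
  hence A': "finite A'" "A' \<noteq> {}" using assms by (auto simp: A'_def)
  hence "Max (Im ` A') \<in> Im ` A'" by (intro Max_in) auto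
  then obtain V where V: "V \<in> A'" "Im V = Max (Im ` A')" by auto
  have "\<not> lexpos (U - V)" if "U \<in> A" for U
  proof -
    have "Re U \<le> Re V" using that V assms by (simp add: A'_def)
    moreover have "Im U \<le> Im V" if "Re U = Re V"
      using that \<open>U \<in> A\<close> V A' by (auto simp: A'_def intro!: Max_ge)
    ultimately show ?thesis by (auto simp: lexpos_def)
  qed
  thus ?thesis using V by (auto simp: A'_def)
qed

lemma sym_adjacency: "sym (adjacency G)"
  by (auto simp: sym_def adjacency_def)

lemma graph_component_eq:
  assumes "C \<in> graph_components G" "x \<in> C"
  shows "C = (adjacency G)\<^sup>* `` {x}"
proof -
  obtain y where y: "C = (adjacency G)\<^sup>* `` {y}" using assms(1) by (auto simp: graph_components_def)
  hence "(y, x) \<in> (adjacency G)\<^sup>*" using assms(2) by auto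
  moreover have "(x, y) \<in> (adjacency G)\<^sup>*"
    using calculation sym_rtrancl[OF sym_adjacency] by (metis symD)
  ultimately show ?thesis unfolding y by (auto intro: rtrancl_trans)
qed

lemma graph_component_closed:
  assumes "C \<in> graph_components G" "x \<in> C" "(x, y) \<in> adjacency G"
  shows "y \<in> C"
  using graph_component_eq[OF assms(1,2)] assms(3) by blast

lemma mesh_finite:
  assumes "quad_mesh M"
  shows "finite (mesh_vertices M)" "finite (mesh_edges M)"
proof -
  have "finite (quad_vertices q)" "finite (quad_edges q)" for q by (cases q, simp)+
  thus "finite (mesh_vertices M)" "finite (mesh_edges M)"
    using meshD(1)[OF assms] by (auto simp: mesh_vertices_def mesh_edges_def)
qed

text \<open>No boundary vertex is \<open>D\<close>-relevant, so the template TB1 never occurs and every relevant vertex is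
  inner.\<close>

locale mesh_without_relevant_boundary = numbered_mesh +
  fixes clamped :: "complex set"
  assumes no_relevant_boundary: "\<And>V. boundary_vertex M V \<Longrightarrow> \<not> D_relevant M num clamped V"
begin

abbreviation G :: dep_graph where "G \<equiv> algorithm_A M num clamped"

abbreviation uses :: "complex \<Rightarrow> complex set \<Rightarrow> bool" where "uses \<equiv> uses_D M num clamped"

abbreviation relevant :: "complex \<Rightarrow> bool" where "relevant \<equiv> D_relevant M num clamped"

lemma not_TB1: "\<not> TB1 M num clamped V"
  using no_relevant_boundary[of V] by (auto simp: D_relevant_def TB1_def)

lemma relevant_iff:
  "relevant V \<longleftrightarrow> inner_vertex M V \<and> even (valence M V) \<and> \<not> regular_4_vertex M num V"
  using not_TB1 by (simp add: D_relevant_def)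

lemma relevant_noncorner: "relevant V \<Longrightarrow> V \<in> noncorner_vertices M"
  using relevant_iff inner_noncorner by blast

lemma uses_D:
  assumes "uses V e"
  shows "relevant V" "V \<in> e" "inner_edge M e" "e \<in> mesh_edges M" "\<exists>U. e = {V, U}"
  using assms by (auto simp: uses_D_def inner_edge_def)

lemma half_edges_iff: "(V, e) \<in> half_edges G \<longleftrightarrow> uses V e"
  using uses_D[of V e]
  by (auto simp: algorithm_A_def delete_primaries_def delete_secondaries_def delete_unused_def split_edges_def)

lemma secondaries_iff: "e \<in> secondaries G \<longleftrightarrow> (\<exists>V. uses V e)"
  using uses_D[of _ e]
  by (auto simp: algorithm_A_def delete_primaries_def delete_secondaries_def delete_unused_def split_edges_def)

lemma primaries_iff: "V \<in> primaries G \<longleftrightarrow> relevant V"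
  using relevant_iff[of V] by (auto simp: algorithm_A_def delete_primaries_def delete_secondaries_def
    delete_unused_def split_edges_def inner_vertex_def)

lemma finite_nodes: "finite (nodes G)"
proof -
  have "primaries G \<subseteq> mesh_vertices M" using primaries_iff relevant_iff by (auto simp: inner_vertex_def)
  moreover have "secondaries G \<subseteq> mesh_edges M" using secondaries_iff uses_D(4) by blast
  ultimately show ?thesis using mesh_finite[OF mesh] by (auto simp: nodes_def intro: finite_subset)
qed

lemma full_edge_iff: "full_edge G e \<longleftrightarrow> (\<exists>V. uses V e) \<and> (\<forall>V \<in> e. uses V e)"
  by (simp add: full_edge_def half_edges_iff secondaries_iff)

lemma dangling_iff: "dangling G V e \<longleftrightarrow> uses V e \<and> (\<forall>U. uses U e \<longrightarrow> U = V)"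
  by (auto simp: dangling_def half_edges_iff)

lemma component_primaries_relevant:
  assumes "C \<in> graph_components G"
  shows "component_primaries C \<subseteq> Collect relevant"
proof
  fix V assume "V \<in> component_primaries C"
  then obtain x where x: "x \<in> nodes G" "(x, Primary V) \<in> (adjacency G)\<^sup>*"
    using assms by (auto simp: component_primaries_def graph_components_def)
  from x(2) show "V \<in> Collect relevant"
    by (cases rule: rtrancl.cases) (use x(1) uses_D(1) in
      \<open>auto simp: nodes_def primaries_iff adjacency_def half_edges_iff\<close>)
qed

lemma finite_component_primaries:
  assumes "C \<in> graph_components G"
  shows "finite (component_primaries C)"
proof -
  have "component_primaries C \<subseteq> mesh_vertices M"
    using component_primaries_relevant[OF assms] relevant_iff by (auto simp: inner_vertex_def)
  thus ?thesis using mesh_finite[OF mesh] finite_subset by blast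
qed

lemma component_primaries_nonempty:
  assumes "C \<in> graph_components G"
  shows "component_primaries C \<noteq> {}"
proof -
  obtain x where x: "x \<in> nodes G" "x \<in> C" using assms by (auto simp: graph_components_def)
  show ?thesis
  proof (cases x)
    case (Primary V)
    thus ?thesis using x by (auto simp: component_primaries_def)
  next
    case (Secondary e)
    then obtain V where "uses V e" using x by (auto simp: nodes_def secondaries_iff)
    hence "(x, Primary V) \<in> adjacency G" using Secondary by (auto simp: adjacency_def half_edges_iff)
    thus ?thesis using graph_component_closed[OF assms x(2)] by (auto simp: component_primaries_def)
  qed
qed

lemma component_of_relevant:
  assumes "relevant V"
  shows "\<exists>C \<in> graph_components G. V \<in> component_primaries C"
proof
  show "(adjacency G)\<^sup>* `` {Primary V} \<in> graph_components G"
    using assms by (auto simp: graph_components_def nodes_def primaries_iff)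
qed (auto simp: component_primaries_def)

lemma component_unique:
  assumes "C \<in> graph_components G" "C' \<in> graph_components G"
    "V \<in> component_primaries C" "V \<in> component_primaries C'"
  shows "C = C'"
  using assms graph_component_eq[of _ G "Primary V"] by (auto simp: component_primaries_def)

lemma component_shares_edge:
  assumes "C \<in> graph_components G" "V \<in> component_primaries C" "uses V e" "uses U e"
  shows "U \<in> component_primaries C"
proof -
  have "(Primary V, Secondary e) \<in> adjacency G" "(Secondary e, Primary U) \<in> adjacency G"
    using assms by (auto simp: adjacency_def half_edges_iff)
  thus ?thesis using assms(2) graph_component_closed[OF assms(1)] by (auto simp: component_primaries_def)
qed

text \<open>At the lexicographically largest primary vertex \<open>V\<close>, take an upward used edge. Its far end is
  larger than \<open>V\<close>, whereas a user of the same D-type point would be in the component.\<close>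

lemma dangling_exists:
  assumes C: "C \<in> graph_components G"
  shows "\<exists>V \<in> component_primaries C. \<exists>e. dangling G V e"
proof -
  obtain V where V: "V \<in> component_primaries C" "\<And>U. U \<in> component_primaries C \<Longrightarrow> \<not> lexpos (U - V)"
    using lexpos_maximum_exists[OF finite_component_primaries component_primaries_nonempty] C by blast
  have rel: "relevant V" using component_primaries_relevant[OF C] V by blast
  hence inner: "inner_vertex M V" "even (valence M V)" "\<not> regular_4_vertex M num V"
    by (simp_all add: relevant_iff)
  from exists_used_edge_upward[OF inner] obtain j where
    j: "j < N V" "lexpos (evec V j)" "coeff num V j \<noteq> 0" by blast
  let ?e = "{V, W V j}"
  have "uses V ?e" using rel j inner_edge_at_inner_vertex[OF inner_noncorner[OF inner(1)] inner(1)]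
    by (auto simp: uses_D_def)
  moreover have "U = V" if "uses U ?e" for U
  proof (rule ccontr)
    assume "U \<noteq> V"
    hence "U = W V j" using uses_D(2)[OF that] by auto
    moreover have "U \<in> component_primaries C"
      using component_shares_edge[OF C V(1) \<open>uses V ?e\<close> that] .
    ultimately show False using V(2) j(2) by (auto simp: edge_vec_def)
  qed
  ultimately have "dangling G V ?e" by (auto simp: dangling_iff)
  thus ?thesis using V(1) by blast
qed

lemma component_spanning_tree:
  assumes C: "C \<in> graph_components G"
  shows "\<exists>F. is_tree (component_primaries C) F \<and> (\<forall>e \<in> F. full_edge G e)"
proof -
  let ?P = "component_primaries C"
  define E where "E = {e. full_edge G e \<and> e \<subseteq> ?P}"
  have "(U, W) \<in> (edge_rel E)\<^sup>*" if U: "U \<in> ?P" and W: "W \<in> ?P" for U W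
  proof -
    \<comment> \<open>A path in the graph alternates between primary and secondary vertices. The invariant at a secondary
      vertex says that all of its users have been reached through full edges.\<close>
    define reached where "reached = (\<lambda>y. case y of Primary W \<Rightarrow> W \<in> ?P \<and> (U, W) \<in> (edge_rel E)\<^sup>*
      | Secondary e \<Rightarrow> \<forall>W. uses W e \<longrightarrow> W \<in> ?P \<and> (U, W) \<in> (edge_rel E)\<^sup>*)"
    have "(Primary U, Primary W) \<in> (adjacency G)\<^sup>*"
      using U W graph_component_eq[OF C, of "Primary U"] by (auto simp: component_primaries_def)
    hence "reached (Primary W)"
    proof (induction rule: rtrancl_induct)
      case base
      show ?case using U by (simp add: reached_def)
    next
      case (step y z)
      show ?case
      proof (cases y)
        case (Secondary e)
        then obtain X where "z = Primary X" "uses X e"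
          using step(2) by (auto simp: adjacency_def half_edges_iff)
        thus ?thesis using step(3) Secondary by (simp add: reached_def)
      next
        case (Primary X)
        then obtain e where e: "z = Secondary e" "uses X e"
          using step(2) by (auto simp: adjacency_def half_edges_iff)
        have X: "X \<in> ?P" "(U, X) \<in> (edge_rel E)\<^sup>*" using step(3) Primary by (auto simp: reached_def)
        have "Y \<in> ?P \<and> (U, Y) \<in> (edge_rel E)\<^sup>*" if Y: "uses Y e" for Y
        proof (cases "X = Y")
          case False
          have "Y \<in> ?P" using component_shares_edge[OF C X(1) e(2) Y] .
          moreover have "e = {X, Y}" using False uses_D(2,5)[OF e(2)] uses_D(2,5)[OF Y] by auto
          ultimately have "(X, Y) \<in> edge_rel E"
            using X e(2) Y by (auto simp: E_def edge_rel_iff full_edge_iff)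
          thus ?thesis using X(2) \<open>Y \<in> ?P\<close> by (meson rtrancl_into_rtrancl)
        qed (use X in simp)
        thus ?thesis using e(1) by (simp add: reached_def)
      qed
    qed
    thus ?thesis by (simp add: reached_def)
  qed
  moreover have "\<forall>e \<in> E. e \<subseteq> ?P" by (simp add: E_def)
  ultimately obtain F where "F \<subseteq> E" "is_tree ?P F"
    using spanning_tree_exists[OF finite_component_primaries[OF C]] by metis
  thus ?thesis by (auto simp: E_def)
qed

lemma algorithm_B_run_exists: "\<exists>rt dang tree. algorithm_B G rt dang tree"
proof -
  have "\<forall>C \<in> graph_components G. \<exists>p. fst p \<in> component_primaries C \<and> dangling G (fst p) (snd p)"
    using dangling_exists by (metis fst_conv snd_conv)
  then obtain p where p: "\<forall>C \<in> graph_components G. fst (p C) \<in> component_primaries C \<and> dangling G (fst (p C)) (snd (p C))"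
    using bchoice[where Q = "\<lambda>C p. fst p \<in> component_primaries C \<and> dangling G (fst p) (snd p)"] by blast
  obtain tree where "\<forall>C \<in> graph_components G. is_tree (component_primaries C) (tree C) \<and> (\<forall>e \<in> tree C. full_edge G e)"
    using bchoice[where Q = "\<lambda>C F. is_tree (component_primaries C) F \<and> (\<forall>e \<in> F. full_edge G e)"]
      component_spanning_tree by blast
  hence "algorithm_B G (\<lambda>C. fst (p C)) (\<lambda>C. snd (p C)) tree" using p by (simp add: algorithm_B_def)
  thus ?thesis by blast
qed

end

section \<open>The forest makes the templates compatible\<close>

lemma distinct_concat_map:
  assumes "distinct Cs" "\<And>C. C \<in> set Cs \<Longrightarrow> distinct (f C)"
    "\<And>C C'. C \<in> set Cs \<Longrightarrow> C' \<in> set Cs \<Longrightarrow> C \<noteq> C' \<Longrightarrow> set (f C) \<inter> set (f C') = {}"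
  shows "distinct (concat (map f Cs))"
  using assms by (induction Cs) fastforce+

context mesh_without_relevant_boundary
begin

lemma T_template_subset: "T_template M num clamped V X \<Longrightarrow> X \<subseteq> T_pts M V"
  by (auto simp: T_template_def split: if_splits)

lemma T_template_exists:
  assumes "V \<in> noncorner_vertices M"
  shows "\<exists>X. T_template M num clamped V X"
proof -
  have "T_pt M num V 0 \<in> T_pts M V" using sectors_pos[OF assms] T_pts_eq[OF assms] by auto
  thus ?thesis unfolding T_template_def by (cases "inner_vertex M V \<and> odd (valence M V)") (auto simp: not_TB1)
qed

lemma D_pt_of_used_edge:
  assumes "uses V e"
  shows "\<exists>k < N V. coeff num V k \<noteq> 0 \<and> DPt e = D_pt num V k"
  using assms by (auto simp: uses_D_def D_pt_def)

context
  fixes rt :: "node set \<Rightarrow> complex" and dang :: "node set \<Rightarrow> complex set"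
    and tree :: "node set \<Rightarrow> complex set set"
  assumes run: "algorithm_B G rt dang tree"
begin

abbreviation directed :: "(complex set \<times> complex) set" where
  "directed \<equiv> directed_edges G rt dang tree"

abbreviation lev :: "node set \<Rightarrow> complex \<Rightarrow> nat" where
  "lev C V \<equiv> level (tree C) (rt C) V"

lemma algorithm_B_run:
  assumes "C \<in> graph_components G"
  shows "rt C \<in> component_primaries C" "dangling G (rt C) (dang C)"
    "e \<in> tree C \<Longrightarrow> e \<subseteq> component_primaries C" "\<nexists>ps. is_cycle (tree C) ps"
    "V \<in> component_primaries C \<Longrightarrow> (rt C, V) \<in> (edge_rel (tree C))\<^sup>*"
    "e \<in> tree C \<Longrightarrow> full_edge G e"
  using run assms unfolding algorithm_B_def is_tree_def by blast+

lemma directed_cases: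
  assumes "(e, V) \<in> directed"
  obtains (tree) C U where "C \<in> graph_components G" "e = {U, V}" "{U, V} \<in> tree C" "lev C U < lev C V"
  | (dang) C where "C \<in> graph_components G" "e = dang C" "V = rt C"
  using assms unfolding directed_edges_def by blast

lemma directed_uses: "(e, V) \<in> directed \<Longrightarrow> uses V e"
proof (erule directed_cases)
  fix C U assume "C \<in> graph_components G" "e = {U, V}" "{U, V} \<in> tree C"
  thus "uses V e" using algorithm_B_run(6)[of C e] by (simp add: full_edge_iff)
next
  fix C assume "C \<in> graph_components G" "e = dang C" "V = rt C"
  thus "uses V e" using algorithm_B_run(2)[of C] by (simp add: dangling_iff)
qed

text \<open>Tree edges are used from both ends, dangling ones from one end only.\<close>

lemma dang_not_in_tree:
  assumes "C \<in> graph_components G" "C' \<in> graph_components G"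
  shows "dang C \<notin> tree C'"
proof
  assume t: "dang C \<in> tree C'"
  have d: "uses (rt C) (dang C)" "\<And>U. uses U (dang C) \<Longrightarrow> U = rt C"
    using algorithm_B_run(2)[OF assms(1)] by (auto simp: dangling_iff)
  obtain U where U: "dang C = {rt C, U}" using uses_D(5)[OF d(1)] by blast
  hence "U = rt C" using algorithm_B_run(6)[OF assms(2) t] d(2) by (auto simp: full_edge_iff)
  moreover have "rt C \<noteq> U" using mesh_edge_distinct[OF mesh] uses_D(4)[OF d(1)] U by simp
  ultimately show False by simp
qed

lemma directed_to_unique_vertex:
  assumes "(e, V) \<in> directed" "(e, V') \<in> directed"
  shows "V = V'"
  using assms(1)
proof (cases rule: directed_cases)
  case (tree C U)
  note t = tree
  from assms(2) show ?thesis
  proof (cases rule: directed_cases)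
    case (tree C' U')
    have "U \<in> component_primaries C" "U \<in> component_primaries C'"
      using algorithm_B_run(3)[OF t(1), of e] algorithm_B_run(3)[OF tree(1), of e] t tree by auto
    hence "C = C'" using component_unique t(1) tree(1) by blast
    thus ?thesis using t tree by (auto simp: doubleton_eq_iff)
  next
    case (dang C')
    thus ?thesis using dang_not_in_tree[of C' C] t by simp
  qed
next
  case (dang C)
  note d = dang
  from assms(2) show ?thesis
  proof (cases rule: directed_cases)
    case (tree C' U')
    thus ?thesis using dang_not_in_tree[of C C'] d by simp
  next
    case (dang C')
    thus ?thesis using d algorithm_B_run(2)[of C] algorithm_B_run(2)[of C'] by (auto simp: dangling_iff)
  qed
qed

lemma directed_edge_exists:
  assumes "relevant V"
  shows "\<exists>e. (e, V) \<in> directed"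
proof -
  obtain C where C: "C \<in> graph_components G" "V \<in> component_primaries C"
    using component_of_relevant[OF assms] by blast
  show ?thesis
  proof (cases "V = rt C")
    case True
    thus ?thesis using C by (auto simp: directed_edges_def)
  next
    case False
    thus ?thesis using parent_exists[OF algorithm_B_run(5)[OF C]] C(1) unfolding directed_edges_def by blast
  qed
qed

text \<open>A vertex below the root has only one parent; the root has level 0, so no tree edge points to it.\<close>

lemma directed_edge_unique:
  assumes "(e, V) \<in> directed" "(e', V) \<in> directed"
  shows "e = e'"
proof -
  obtain C where C: "C \<in> graph_components G" "V \<in> component_primaries C"
    using component_of_relevant[OF uses_D(1)[OF directed_uses[OF assms(1)]]] by blast
  have in_C: "C' = C" if "C' \<in> graph_components G" "V \<in> component_primaries C'" for C'
    using component_unique C that by blast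
  have "(\<exists>U. e = {U, V} \<and> {U, V} \<in> tree C \<and> lev C U < lev C V) \<or> e = dang C \<and> V = rt C"
    if "(e, V) \<in> directed" for e
    using that
  proof (cases rule: directed_cases)
    case (tree C' U)
    thus ?thesis using in_C[of C'] algorithm_B_run(3)[of C' e] by auto
  next
    case (dang C')
    thus ?thesis using in_C[of C'] algorithm_B_run(1)[of C'] by auto
  qed
  note cases = this[OF assms(1)] this[OF assms(2)]
  show ?thesis
  proof (cases "V = rt C")
    case True
    have "lev C (rt C) = 0" using level_le[of "rt C" "rt C" 0] by simp
    thus ?thesis using cases True by auto
  next
    case False
    then obtain U U' where U: "e = {U, V}" "{U, V} \<in> tree C" "lev C U < lev C V"
      and U': "e' = {U', V}" "{U', V} \<in> tree C" "lev C U' < lev C V" using cases by blast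
    have "U \<in> component_primaries C" "U' \<in> component_primaries C"
      using algorithm_B_run(3)[OF C(1)] U(2) U'(2) by auto
    hence reach: "(rt C, U) \<in> (edge_rel (tree C))\<^sup>*" "(rt C, U') \<in> (edge_rel (tree C))\<^sup>*"
      using algorithm_B_run(5)[OF C(1)] by blast+
    have "U \<noteq> V" "U' \<noteq> V" using U(3) U'(3) by auto
    hence "U = U'"
      using parent_unique[OF algorithm_B_run(4)[OF C(1)] U(2) U'(2) _ _ reach] U(3) U'(3) by simp
    thus ?thesis using U U' by simp
  qed
qed

text \<open>A vertex using a D-type point that is assigned elsewhere is the parent of the vertex to which it
  is assigned: the alternative, a dangling edge at the root, is used by the root only.\<close>

lemma used_directed_edge_points_down:
  assumes "(e, U) \<in> directed" "uses V e" "V \<noteq> U"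
  shows "\<exists>C \<in> graph_components G. V \<in> component_primaries C \<and> U \<in> component_primaries C \<and> lev C V < lev C U"
  using assms(1)
proof (cases rule: directed_cases)
  case (tree C U')
  hence "V = U'" using uses_D(2)[OF assms(2)] assms(3) by auto
  thus ?thesis using tree algorithm_B_run(3)[OF tree(1,3)] by auto
next
  case (dang C)
  thus ?thesis using algorithm_B_run(2)[OF dang(1)] assms by (auto simp: dangling_iff)
qed

text \<open>The third part gives the bottom-up order needed for elimination: in a component, lower
  vertices have larger levels and come first.\<close>

lemma forest_traversal_props:
  assumes "forest_traversal G rt tree us"
  shows "distinct us" "set us = Collect relevant"
    "C \<in> graph_components G \<Longrightarrow> V \<in> component_primaries C \<Longrightarrow> U \<in> component_primaries C \<Longrightarrow>
      lev C V < lev C U \<Longrightarrow> i < length us \<Longrightarrow> us ! i = V \<Longrightarrow> \<exists>k < i. us ! k = U"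
proof -
  obtain Cs trav where Cs: "distinct Cs" "set Cs = graph_components G" "us = concat (map trav Cs)"
    and trav: "\<And>C. C \<in> graph_components G \<Longrightarrow> distinct (trav C)"
      "\<And>C. C \<in> graph_components G \<Longrightarrow> set (trav C) = component_primaries C"
      "\<And>C. C \<in> graph_components G \<Longrightarrow> sorted_wrt (\<lambda>V U. lev C V \<ge> lev C U) (trav C)"
    using assms unfolding forest_traversal_def by metis
  show dist: "distinct us"
    unfolding Cs(3)
  proof (rule distinct_concat_map)
    fix C C' assume "C \<in> set Cs" "C' \<in> set Cs" "C \<noteq> C'"
    thus "set (trav C) \<inter> set (trav C') = {}"
      using component_unique[of C C'] unfolding Cs(2) by (auto simp: trav(2))
  qed (use Cs trav(1) in auto)
  show "set us = Collect relevant"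
    using Cs trav component_of_relevant component_primaries_relevant by fastforce
  assume C: "C \<in> graph_components G" and VU: "V \<in> component_primaries C" "U \<in> component_primaries C"
    "lev C V < lev C U" and i: "i < length us" "us ! i = V"
  obtain Cs1 Cs2 where "Cs = Cs1 @ C # Cs2" using C Cs(2) by (metis split_list)
  then obtain pre post where us: "us = pre @ trav C @ post" using Cs(3) by auto
  obtain a b where ab: "a < length (trav C)" "trav C ! a = V" "b < length (trav C)" "trav C ! b = U"
    using VU(1,2) trav(2)[OF C] by (metis in_set_conv_nth)
  have "\<not> a < b" using sorted_wrt_nth_less[OF trav(3)[OF C], of a b] ab VU(3) by auto
  moreover have "a \<noteq> b" using ab VU(3) by auto
  ultimately have "b < a" by simp
  moreover have "i = length pre + a"
    using nth_eq_iff_index_eq[OF dist i(1), of "length pre + a"] i(2) ab unfolding us by (simp add: nth_append)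
  moreover have "us ! (length pre + b) = U" using ab unfolding us by (simp add: nth_append)
  ultimately show "\<exists>k < i. us ! k = U" by (intro exI[of _ "length pre + b"]) simp
qed

lemma forest_traversal_exists: "\<exists>us. forest_traversal G rt tree us"
proof -
  have "finite (graph_components G)"
  proof -
    have "graph_components G = (\<lambda>x. (adjacency G)\<^sup>* `` {x}) ` nodes G" by (auto simp: graph_components_def)
    thus ?thesis using finite_nodes by simp
  qed
  then obtain Cs where Cs: "distinct Cs" "set Cs = graph_components G"
    using finite_distinct_list by blast
  have "\<exists>xs. distinct xs \<and> set xs = component_primaries C \<and> sorted_wrt (\<lambda>V U. lev C V \<ge> lev C U) xs"
    if C: "C \<in> graph_components G" for C
  proof -
    obtain xs where xs: "distinct xs" "set xs = component_primaries C"
      using finite_distinct_list[OF finite_component_primaries[OF C]] by blast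
    have "sorted_wrt (\<lambda>V U. lev C V \<ge> lev C U) (rev (sort_key (lev C) xs))"
      using sorted_sort_key[of "lev C" xs] by (simp add: sorted_wrt_rev sorted_map)
    thus ?thesis using xs by (intro exI[of _ "rev (sort_key (lev C) xs)"]) simp
  qed
  then obtain trav where "\<forall>C \<in> graph_components G. distinct (trav C) \<and> set (trav C) = component_primaries C \<and>
      sorted_wrt (\<lambda>V U. lev C V \<ge> lev C U) (trav C)" by metis
  thus ?thesis using Cs unfolding forest_traversal_def by metis
qed

lemma algorithm_C_iff:
  "algorithm_C M num clamped G rt dang tree B dep vs \<longleftrightarrow>
    (\<exists>T us ws. (\<forall>V \<in> noncorner_vertices M. T_template M num clamped V (T V)) \<and>
      B = {DPt e | e. inner_edge M e \<and> (\<nexists>V. (e, V) \<in> directed)}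
          \<union> (\<Union>V \<in> noncorner_vertices M. T_pts M V - T V) \<and>
      (\<forall>V \<in> noncorner_vertices M. dep V = {DPt e | e. (e, V) \<in> directed} \<union> T V) \<and>
      forest_traversal G rt tree us \<and>
      distinct ws \<and> set ws = {V \<in> noncorner_vertices M. \<not> relevant V} \<and> vs = us @ ws)"
proof -
  have none: "{V \<in> noncorner_vertices M. boundary_vertex M V \<and> relevant V} = {}"
    using no_relevant_boundary by blast
  show ?thesis unfolding algorithm_C_def Let_def none by simp
qed

lemma algorithm_C_run_exists: "\<exists>B dep vs. algorithm_C M num clamped G rt dang tree B dep vs"
proof -
  obtain T where T: "\<forall>V \<in> noncorner_vertices M. T_template M num clamped V (T V)"
    using T_template_exists by metis
  obtain us where us: "forest_traversal G rt tree us" using forest_traversal_exists by blast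
  have "finite (noncorner_vertices M)"
    using mesh_finite(1)[OF mesh] by (simp add: noncorner_vertices_def)
  then obtain ws where ws: "distinct ws" "set ws = {V \<in> noncorner_vertices M. \<not> relevant V}"
    using finite_distinct_list[of "{V \<in> noncorner_vertices M. \<not> relevant V}"] by auto
  show ?thesis unfolding algorithm_C_iff
    by (intro exI[of _ T] exI[of _ us] exI[of _ ws] exI conjI refl ballI) (use T us ws in auto)
qed

text \<open>Each template receives exactly one D-type point at a relevant vertex and none elsewhere. A used
  point that is dependent elsewhere is treated earlier: at a relevant vertex it belongs to a child,
  and the other vertices follow after the whole forest. This order is also what makes the system of
  all equations triangular.\<close>

lemma algorithm_C_global_classification:
  assumes "algorithm_C M num clamped G rt dang tree B dep vs"
  shows "global_classification M num clamped B dep vs"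
proof -
  let ?NC = "noncorner_vertices M"
  obtain T us ws where T': "\<forall>V \<in> ?NC. T_template M num clamped V (T V)"
    and B: "B = {DPt e | e. inner_edge M e \<and> (\<nexists>V. (e, V) \<in> directed)} \<union> (\<Union>V \<in> ?NC. T_pts M V - T V)"
    and dep': "\<forall>V \<in> ?NC. dep V = {DPt e | e. (e, V) \<in> directed} \<union> T V"
    and us: "forest_traversal G rt tree us"
    and ws: "distinct ws" "set ws = {V \<in> ?NC. \<not> relevant V}" and vs: "vs = us @ ws"
    using assms unfolding algorithm_C_iff by blast
  note T = T'[rule_format] and dep = dep'[rule_format]
  note us' = forest_traversal_props[OF us]
  have T_sub: "T V \<subseteq> T_pts M V" if "V \<in> ?NC" for V
    using T_template_subset[OF T[OF that]] .
  have set_vs: "set vs = ?NC"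
    unfolding vs set_append us'(2) ws(2) using relevant_noncorner by blast
  have dist: "distinct vs"
    unfolding vs distinct_append us'(2) ws(2) using us'(1) ws(1) by blast
  have vs_nc: "vs ! i \<in> ?NC" if "i < length vs" for i
    using nth_mem[OF that] unfolding set_vs .
  have D_vertex: "V \<in> ?NC" if "(e, V) \<in> directed" for e V
    using relevant_noncorner[OF uses_D(1)[OF directed_uses[OF that]]] .

  have template: "local_template M num clamped V (dep V)" if V: "V \<in> ?NC" for V
  proof -
    have "D_template M num clamped V {DPt e | e. (e, V) \<in> directed}"
    proof (cases "relevant V")
      case True
      then obtain e where e: "(e, V) \<in> directed" using directed_edge_exists by blast
      hence "{DPt e | e. (e, V) \<in> directed} = {DPt e}" using directed_edge_unique by blast
      thus ?thesis using D_pt_of_used_edge[OF directed_uses[OF e]] True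
        by (auto simp: D_template_def not_TB1 relevant_iff)
    next
      case False
      hence "{DPt e | e. (e, V) \<in> directed} = {}" using directed_uses uses_D(1) by blast
      thus ?thesis using False by (simp add: D_template_def not_TB1 relevant_iff)
    qed
    thus ?thesis using T[OF V] dep[OF V] unfolding local_template_def by blast
  qed

  have disjoint: "dep V \<inter> dep W = {}" if "V \<in> ?NC" "W \<in> ?NC" "V \<noteq> W" for V W
  proof -
    have "T_pts M V \<inter> T_pts M W = {}" using that by (auto simp: T_pts_def)
    moreover have "DPt e \<notin> T_pts M X" for e X by (simp add: T_pts_def)
    ultimately show ?thesis
      using directed_to_unique_vertex that(3) T_sub[OF that(1)] T_sub[OF that(2)]
      unfolding dep[OF that(1)] dep[OF that(2)] by blast
  qed

  have dep_T: "dep V \<inter> T_pts M V = T V" "dep V \<inter> range DPt = {DPt e | e. (e, V) \<in> directed}"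
    if "V \<in> ?NC" for V
    using T_sub[OF that] unfolding dep[OF that] by (auto simp: T_pts_def)

  have B_disj: "B \<inter> (\<Union>V \<in> ?NC. dep V) = {}"
  proof -
    have "p \<notin> dep V" if "p \<in> B" "V \<in> ?NC" for p V
    proof -
      from \<open>p \<in> B\<close> consider e where "p = DPt e" "\<nexists>V. (e, V) \<in> directed"
        | W where "W \<in> ?NC" "p \<in> T_pts M W" "p \<notin> T W" unfolding B by blast
      thus ?thesis
      proof cases
        case 1
        thus ?thesis using dep_T(2)[OF that(2)] by blast
      next
        case 2
        hence "p \<in> dep V \<Longrightarrow> V = W"
          using T_sub[OF that(2)] unfolding dep[OF that(2)] by (auto simp: T_pts_def)
        thus ?thesis using 2 dep_T(1)[OF that(2)] by blast
      qed
    qed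
    thus ?thesis by blast
  qed

  have B_union: "B \<union> (\<Union>V \<in> ?NC. dep V) = D_points M \<union> T_points M"
  proof (intro equalityI subsetI)
    fix p assume "p \<in> B \<union> (\<Union>V \<in> ?NC. dep V)"
    thus "p \<in> D_points M \<union> T_points M"
      using T_sub uses_D(3)[OF directed_uses] dep unfolding B D_points_def T_points_def by fastforce
  next
    fix p assume "p \<in> D_points M \<union> T_points M"
    then consider e where "p = DPt e" "inner_edge M e" | V where "V \<in> ?NC" "p \<in> T_pts M V"
      by (auto simp: D_points_def T_points_def)
    thus "p \<in> B \<union> (\<Union>V \<in> ?NC. dep V)"
    proof cases
      case 1
      show ?thesis
      proof (cases "\<exists>V. (e, V) \<in> directed")
        case True
        then obtain V where "(e, V) \<in> directed" by blast
        thus ?thesis using 1 D_vertex[of e V] dep[of V] by blast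
      qed (use 1 in \<open>auto simp: B\<close>)
    next
      case 2
      thus ?thesis using dep[OF 2(1)] unfolding B by blast
    qed
  qed

  have order: "occurring M num (vs ! i) - dep (vs ! i) \<subseteq> B \<union> (\<Union>k < i. dep (vs ! k))"
    if i: "i < length vs" for i
  proof
    let ?V = "vs ! i"
    note V = vs_nc[OF i]
    fix p assume p: "p \<in> occurring M num ?V - dep ?V"
    then consider j where "p = D_pt num ?V j" "j < N ?V" "inner_edge M {?V, W ?V j}" "coeff num ?V j \<noteq> 0"
      | "p \<in> T_pts M ?V" by (auto simp: occurring_def)
    thus "p \<in> B \<union> (\<Union>k < i. dep (vs ! k))"
    proof cases
      case 2
      thus ?thesis using p dep_T(1)[OF V] V unfolding B by blast
    next
      case (1 j)
      define e where "e = {?V, W ?V j}"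
      have pe: "p = DPt e" using 1 by (simp add: e_def D_pt_def)
      show ?thesis
      proof (cases "\<exists>U. (e, U) \<in> directed")
        case False
        thus ?thesis using 1 pe unfolding B e_def by blast
      next
        case True
        then obtain U where U: "(e, U) \<in> directed" by blast
        have pU: "p \<in> dep U" using U pe dep[OF D_vertex[OF U]] by blast
        hence neq: "?V \<noteq> U" using p by auto
        have "\<exists>k < i. vs ! k = U"
        proof (cases "i < length us")
          case True
          have usi: "us ! i = ?V" using True by (simp add: vs nth_append)
          hence "relevant ?V" using us'(2) True by (metis mem_Collect_eq nth_mem)
          hence "uses ?V e" using 1 by (auto simp: uses_D_def e_def)
          from used_directed_edge_points_down[OF U this neq] obtain C where
            "C \<in> graph_components G" "?V \<in> component_primaries C" "U \<in> component_primaries C"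
            "lev C ?V < lev C U" by blast
          from us'(3)[OF this True usi] obtain k where "k < i" "us ! k = U" by blast
          thus ?thesis using True by (intro exI[of _ k]) (simp add: vs nth_append)
        next
          case False
          have "U \<in> set us" using us'(2) uses_D(1)[OF directed_uses[OF U]] by simp
          then obtain k where "k < length us" "us ! k = U" by (auto simp: in_set_conv_nth)
          thus ?thesis using False by (intro exI[of _ k]) (simp add: vs nth_append)
        qed
        thus ?thesis using pU by blast
      qed
    qed
  qed

  have rule: "\<exists>!x. D_rule M num (Z(p := x)) V" if pV: "V \<in> ?NC" "p \<in> dep V \<inter> D_points M" for V p Z
  proof -
    have "p \<in> dep V \<inter> range DPt" using pV(2) by (auto simp: D_points_def)
    then obtain e where e: "p = DPt e" "(e, V) \<in> directed"
      unfolding dep_T(2)[OF pV(1)] by blast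
    obtain k where k: "k < N V" "coeff num V k \<noteq> 0" "p = D_pt num V k"
      using D_pt_of_used_edge[OF directed_uses[OF e(2)]] e(1) by blast
    have "inner_vertex M V" using uses_D(1)[OF directed_uses[OF e(2)]] relevant_iff by blast
    thus ?thesis using circular_constraint_unique_D[OF pV(1) k(1,2)] by (simp add: D_rule_def k(3))
  qed

  have solve: "\<exists>!Z'. (\<forall>p. p \<notin> (\<Union>V \<in> set vs. dep V) \<longrightarrow> Z' p = Z p) \<and> (\<forall>V \<in> set vs. Eq1_at M num Z' V)" for Z
  proof -
    have "\<exists>!Z'. solves_off (\<lambda>Z'. \<forall>V \<in> set vs. Eq1_at M num Z' V) (\<Union>V \<in> set vs. dep V) Z Z'"
    proof (rule triangular_solution)
      show "\<exists>!Z'. solves_off (\<lambda>Z'. Eq1_at M num Z' (vs ! i)) (dep (vs ! i)) Z Z'" if "i < length vs" for i Z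
        using local_template_solvable[OF vs_nc[OF that] not_TB1 template[OF vs_nc[OF that]]] .
      have neq: "vs ! k \<noteq> vs ! i" if "k < i" "i < length vs" for i k
        using that dist by (simp add: nth_eq_iff_index_eq)
      show disj: "dep (vs ! k) \<inter> dep (vs ! i) = {}" if "k < i" "i < length vs" for i k
        using disjoint[OF vs_nc vs_nc neq[OF that]] that by simp
      show "Eq1_at M num Z (vs ! k) = Eq1_at M num Z' (vs ! k)"
        if "k < i" "i < length vs" and off: "\<And>p. p \<notin> dep (vs ! i) \<Longrightarrow> Z p = Z' p" for i k Z Z'
      proof (rule Eq1_at_cong)
        have "dep (vs ! i) \<subseteq> range DPt \<union> T_pts M (vs ! i)"
          using T_sub[OF vs_nc[OF that(2)]] dep[OF vs_nc[OF that(2)]] by auto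
        thus "same_VE Z Z'" using same_VE_if_equal_off off by blast
        fix p assume p: "p \<in> occurring M num (vs ! k)"
        have "p \<notin> dep (vs ! i)"
        proof
          assume pi: "p \<in> dep (vs ! i)"
          hence "p \<notin> dep (vs ! k)" using disj[OF that(1,2)] by blast
          hence "p \<in> B \<union> (\<Union>l < k. dep (vs ! l))" using order[of k] p that(1,2) by auto
          moreover have "p \<notin> B" using B_disj pi vs_nc[OF that(2)] by blast
          moreover have "p \<notin> dep (vs ! l)" if "l < k" for l
            using disj[of l i] pi that \<open>k < i\<close> \<open>i < length vs\<close> by auto
          ultimately show False by blast
        qed
        thus "Z p = Z' p" by (rule off)
      qed (use vs_nc that in simp)
    qed
    thus ?thesis by (simp add: solves_off_def)
  qed

  show ?thesis unfolding global_classification_def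
    using dist set_vs template disjoint B_disj B_union order rule solve by auto
qed

end

end

theorem theorem6:
  fixes M :: "quad set"
    and num :: "complex \<Rightarrow> complex list"
    and clamped :: "complex set"
  assumes mesh: "quad_mesh M"
    and limitations: "mesh_limitations M"
    and numbering: "ccw_numbering M num"
    and no_relevant_boundary: "\<forall>V. boundary_vertex M V \<longrightarrow> \<not> D_relevant M num clamped V"
  shows "let G = algorithm_A M num clamped in
    (nodes G = {} \<or>
      (\<forall>C \<in> graph_components G. \<exists>V \<in> component_primaries C. \<exists>e. dangling G V e)) \<and>
    (\<exists>B dep vs. global_classification M num clamped B dep vs) \<and>
    (\<exists>rt dang tree. algorithm_B G rt dang tree) \<and>
    (\<forall>rt dang tree. algorithm_B G rt dang tree \<longrightarrow>
      (\<exists>B dep vs. algorithm_C M num clamped G rt dang tree B dep vs) \<and>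
      (\<forall>B dep vs. algorithm_C M num clamped G rt dang tree B dep vs \<longrightarrow>
         global_classification M num clamped B dep vs))"
proof -
  interpret mesh_without_relevant_boundary M num clamped
    by unfold_locales (use assms in auto)
  have "\<exists>B dep vs. global_classification M num clamped B dep vs"
    using algorithm_B_run_exists algorithm_C_run_exists algorithm_C_global_classification by blast
  thus ?thesis unfolding Let_def
    using dangling_exists algorithm_B_run_exists algorithm_C_run_exists algorithm_C_global_classification
    by blast
qed

end
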